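(* There is an isomorphism of $\mathbb Z$-modules $H^*(\mathcal Z_n^1;\mathbb Z)\cong\mathbb Z[z_{ij},z_i]/\mathcal J$ (variables $z_{ij}$ for $i\neq j\in[n]^\pm$ and $z_i$ for $i\in[n]^\pm$, corresponding to the functions of the same names), where $\mathcal J$ is generated, for pairwise distinct indices for which the variables are defined, by (i) $z_{ij}(1-z_{ij})$; (ii) $z_i(1-z_i)$; (iii) $z_i-z_j+z_{ij}-z_{\bar i\bar j}$; (iv) $z_i-(1-z_{\bar i})$; (v) $z_{ij}z_{jk}(1-z_{ik})+(1-z_{ij})(1-z_{jk})z_{ik}$; (vi) $z_{ij}z_i(1-z_j)+(1-z_{ij})(1-z_i)z_j$; (vii) $z_jz_{i\bar j}(1-z_{ij})+(1-z_j)(1-z_{i\bar j})z_{ij}$.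
   Context: Let $[n]^\pm=\{1,\bar1,\dots,n,\bar n\}$ with $\bar{\bar i}=i$, and $\varphi(x)=-x/|x|^2$ on $\mathbb R\setminus\{0\}$ (so $\varphi(x)=-1/x$). Let $\mathcal Z_n^1=\{(x_1,\dots,x_n)\in(\mathbb R\setminus\{0\})^n: x_i\neq x_j,\ x_i\neq\varphi(x_j)\text{ for }i\ne j\}$; it is a disjoint union of contractible pieces, so its integral cohomology is the ring of locally constant $\mathbb Z$-valued functions. For a point put $x_{\bar i}:=\varphi(x_i)$; for $i\in[n]^\pm$ let $z_i=1$ if $x_i>0$ and $0$ otherwise, and for $i\ne j\in[n]^\pm$ let $z_{ij}=1$ if $x_i<x_j$ and $0$ otherwise.
   Formalization: The relations z_ij + z_ji = 1 (i ≠ j) are added to the generators (i)–(vii) of J; without them the claim fails for every n ≥ 2, since z_ij = z_ji = 1 for all i, j of equal sign also satisfies (i)–(vii), making the quotient's rank too large. *)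

theory Defs
  imports "HOL-Homology.Homology" "HOL-Algebra.QuotRing" "HOL-Analysis.Analysis"
begin

text \<open>The cochain complex is \<open>Hom(C\<^sub>p(X), \<int>)\<close>; as usual in HOL-Algebra, homomorphisms are
  made extensional so that equality of cochains is equality of functions.\<close>

definition cochain_group :: "nat \<Rightarrow> 'a topology \<Rightarrow> ('a chain \<Rightarrow> int) monoid" where
  "cochain_group p X =
     \<lparr>carrier = hom (chain_group p X) integer_group \<inter> extensional (carrier (chain_group p X)),
      monoid.mult = (\<lambda>f g. \<lambda>c\<in>carrier (chain_group p X). f c + g c),
      one = (\<lambda>c\<in>carrier (chain_group p X). 0)\<rparr>"

definition coboundary :: "nat \<Rightarrow> 'a topology \<Rightarrow> ('a chain \<Rightarrow> int) \<Rightarrow> 'a chain \<Rightarrow> int" where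
  "coboundary p X f = (\<lambda>c\<in>carrier (chain_group (Suc p) X). f (chain_boundary (Suc p) c))"

definition cocycle_group :: "nat \<Rightarrow> 'a topology \<Rightarrow> ('a chain \<Rightarrow> int) monoid" where
  "cocycle_group p X =
     subgroup_generated (cochain_group p X)
       (kernel (cochain_group p X) (cochain_group (Suc p) X) (coboundary p X))"

definition coboundary_set :: "nat \<Rightarrow> 'a topology \<Rightarrow> ('a chain \<Rightarrow> int) set" where
  "coboundary_set p X =
     (case p of 0 \<Rightarrow> {\<one>\<^bsub>cochain_group 0 X\<^esub>}
              | Suc q \<Rightarrow> coboundary q X ` carrier (cochain_group q X))"

definition cohomology_group :: "nat \<Rightarrow> 'a topology \<Rightarrow> ('a chain \<Rightarrow> int) set monoid" where
  "cohomology_group p X = cocycle_group p X Mod coboundary_set p X"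

definition total_cohomology :: "'a topology \<Rightarrow> (nat \<Rightarrow> ('a chain \<Rightarrow> int) set) monoid" where
  "total_cohomology X = sum_group UNIV (\<lambda>p. cohomology_group p X)"

text \<open>A function \<open>f\<close> on the space gives the 0-cochain sending a 0-simplex, i.e. a point \<open>x\<close>, to
  \<open>f x\<close>. It is a cocycle when \<open>f\<close> is locally constant, and \<open>function_class X f\<close> is then its class,
  placed in degree 0 of the total cohomology.\<close>

definition function_cochain :: "'a topology \<Rightarrow> ('a \<Rightarrow> int) \<Rightarrow> 'a chain \<Rightarrow> int" where
  "function_cochain X f =
     (\<lambda>c\<in>carrier (chain_group 0 X).
        \<Sum>\<sigma>\<in>Poly_Mapping.keys c. Poly_Mapping.lookup c \<sigma> * f (simplicial_vertex 0 \<sigma>))"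

definition function_class :: "'a topology \<Rightarrow> ('a \<Rightarrow> int) \<Rightarrow> nat \<Rightarrow> ('a chain \<Rightarrow> int) set" where
  "function_class X f =
     (\<lambda>p. if p = 0 then coboundary_set 0 X #>\<^bsub>cocycle_group 0 X\<^esub> function_cochain X f
          else \<one>\<^bsub>cohomology_group p X\<^esub>)"

text \<open>A finite index type \<open>'n\<close> plays the role of \<open>{1,\<dots>,n}\<close>, and \<open>'n signed\<close> that of \<open>[n]\<^sup>\<plusminus>\<close>.\<close>

datatype 'n signed = Plain 'n | Barred 'n

fun bar :: "'n signed \<Rightarrow> 'n signed" where
  "bar (Plain i) = Barred i"
| "bar (Barred i) = Plain i"

definition phi :: "real \<Rightarrow> real" where
  "phi x = - x / \<bar>x\<bar>\<^sup>2"

definition Zspace :: "(real ^ 'n::finite) set" where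
  "Zspace = {x. (\<forall>i. x $ i \<noteq> 0) \<and> (\<forall>i j. i \<noteq> j \<longrightarrow> x $ i \<noteq> x $ j \<and> x $ i \<noteq> phi (x $ j))}"

fun coord :: "real ^ 'n::finite \<Rightarrow> 'n signed \<Rightarrow> real" where
  "coord x (Plain i) = x $ i"
| "coord x (Barred i) = phi (x $ i)"

text \<open>With the convolution product, \<open>('v \<Rightarrow>\<^sub>0 nat) \<Rightarrow>\<^sub>0 int\<close> is the polynomial ring over \<open>\<int>\<close> in
  variables \<open>'v\<close>; monomials are exponent vectors. The constructor \<open>ZZ i j\<close> stands for \<open>z\<^sub>i\<^sub>j\<close>, \<open>Z i\<close>
  for \<open>z\<^sub>i\<close>; since \<open>z\<^sub>i\<^sub>i\<close> is not a variable, the ring consists of the polynomials in which no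
  \<open>ZZ i i\<close> occurs.\<close>

datatype 'n zvar = ZZ "'n signed" "'n signed" | Z "'n signed"

type_synonym 'n zpoly = "('n zvar \<Rightarrow>\<^sub>0 nat) \<Rightarrow>\<^sub>0 int"

definition zvars :: "'n zvar set" where
  "zvars = {ZZ i j | i j. i \<noteq> j} \<union> range Z"

definition zpoly_ring :: "'n zpoly ring" where
  "zpoly_ring =
     \<lparr>carrier = {p. \<forall>m\<in>Poly_Mapping.keys p. Poly_Mapping.keys m \<subseteq> zvars},
      monoid.mult = (*), one = 1, zero = 0, add = (+)\<rparr>"

definition zz :: "'n signed \<Rightarrow> 'n signed \<Rightarrow> 'n zpoly" where
  "zz i j = Poly_Mapping.single (Poly_Mapping.single (ZZ i j) 1) 1"

definition z1 ::  "'n signed \<Rightarrow> 'n zpoly" where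
  "z1 i = Poly_Mapping.single (Poly_Mapping.single (Z i) 1) 1"

definition zrelations :: "'n zpoly set" where
  "zrelations =
     {zz i j * (1 - zz i j) | i j. i \<noteq> j}
   \<union> {z1 i * (1 - z1 i) | i. True}
   \<union> {z1 i - z1 j + zz i j - zz (bar i) (bar j) | i j. i \<noteq> j}
   \<union> {z1 i - (1 - z1 (bar i)) | i. True}
   \<union> {zz i j * zz j k * (1 - zz i k) + (1 - zz i j) * (1 - zz j k) * zz i k
        | i j k. i \<noteq> j \<and> j \<noteq> k \<and> i \<noteq> k}
   \<union> {zz i j * z1 i * (1 - z1 j) + (1 - zz i j) * (1 - z1 i) * z1 j | i j. i \<noteq> j}
   \<union> {z1 j * zz i (bar j) * (1 - zz i j) + (1 - z1 j) * (1 - zz i (bar j)) * zz i j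
        | i j. i \<noteq> j \<and> i \<noteq> bar j}"

text \<open>The convention \<open>z\<^sub>j\<^sub>i = 1 - z\<^sub>i\<^sub>j\<close> relating the two names of the comparison of \<open>x\<^sub>i\<close> and \<open>x\<^sub>j\<close>.
  It is not a consequence of \<open>zrelations\<close>: if all \<open>x\<^sub>i\<close> with \<open>i\<close> unbarred are declared positive, then
  \<open>zrelations\<close> also admits \<open>z\<^sub>i\<^sub>j = z\<^sub>j\<^sub>i = 1\<close> for all \<open>i \<noteq> j\<close> of equal sign.\<close>

definition zswap :: "'n zpoly set" where
  "zswap = {zz i j - (1 - zz j i) | i j. i \<noteq> j}"

definition zideal :: "'n zpoly set" where
  "zideal = Idl\<^bsub>zpoly_ring\<^esub> (zrelations \<union> zswap)"

fun zfun :: "real ^ 'n::finite \<Rightarrow> 'n zvar \<Rightarrow> int" where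
  "zfun x (ZZ i j) = (if coord x i < coord x j then 1 else 0)"
| "zfun x (Z i) = (if coord x i > 0 then 1 else 0)"

definition zpoly_eval :: "('n zvar \<Rightarrow> int) \<Rightarrow> 'n zpoly \<Rightarrow> int" where
  "zpoly_eval a p =
     (\<Sum>m\<in>Poly_Mapping.keys p. Poly_Mapping.lookup p m *
        (\<Prod>v\<in>Poly_Mapping.keys m. a v ^ Poly_Mapping.lookup m v))"

end

theory Submission
  imports Defs
begin

text \<open>In the coordinates \<open>s = sgn u\<close>, \<open>t = sgn u * ln \<bar>u\<bar>\<close> the map \<open>phi\<close> only flips \<open>s\<close>, so \<open>Zspace\<close> is
  \<open>{\<plusminus>1}\<^sup>n\<close> times the space of vectors with distinct entries \<open>t\<^sub>i\<close>. Moving \<open>t\<close> along a straight line to a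
  vector that depends only on the order of its entries is a homotopy from the identity to a locally
  constant map, so the cohomology is concentrated in degree 0, where it consists of the functions of
  the values \<open>zfun x\<close>.

  On the algebraic side, the relations (i) and (ii) decompose the polynomial ring modulo the ideal into
  one summand for each 0/1 assignment of the variables. A summand is killed if some relation takes a
  unit value at the assignment; otherwise all relations vanish there, and the assignment is a linear
  order compatible with the bar, hence realized by a point of \<open>Zspace\<close>.\<close>

section \<open>Singular cohomology\<close>

text \<open>Vanishing homology does not dualize by itself: a cochain \<open>f\<close> that kills all
  boundaries has to be written as \<open>g \<circ> \<partial>\<close> with \<open>g\<close> defined
  on every chain. Chains are free, so a linear map \<open>K\<close> can be prescribed on simplices;
  if \<open>\<partial> \<circ> K\<close> is the identity on boundaries, then
  \<open>g = f \<circ> K\<close> works. The existence of \<open>K\<close> rests on cycles of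
  positive degree being boundaries: the homotopy moves a cycle to constant simplices, between which
  the boundary maps are alternately zero and bijective.

  On the algebraic side the coefficients are integers, so a relation that is merely nonzero at an
  assignment would leave a torsion summand; one of value 1 or -1 has to be found. The two sides meet
  because \<open>zfun\<close> is constant on connected sets and its values determine the image under
  \<open>straighten 1\<close>. Degree 0 thus becomes interpolation on the finite set of realized
  assignments.\<close>

lemma carrier_cochain_group:
  "f \<in> carrier (cochain_group p X) \<longleftrightarrow>
     f \<in> extensional (singular_chain_set p X) \<and>
     (\<forall>a b. singular_chain p X a \<longrightarrow> singular_chain p X b \<longrightarrow> f (a + b) = f a + f b)"
  by (auto simp: cochain_group_def hom_def)

lemma mult_cochain_group:
  "f \<otimes>\<^bsub>cochain_group p X\<^esub> g = (\<lambda>c\<in>singular_chain_set p X. f c + g c)"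
  by (simp add: cochain_group_def)

lemma one_cochain_group: "\<one>\<^bsub>cochain_group p X\<^esub> = (\<lambda>c\<in>singular_chain_set p X. 0)"
  by (simp add: cochain_group_def)

lemma comm_group_cochain_group: "comm_group (cochain_group p X)"
proof (rule comm_groupI)
  fix f assume f: "f \<in> carrier (cochain_group p X)"
  show "\<exists>g\<in>carrier (cochain_group p X). g \<otimes>\<^bsub>cochain_group p X\<^esub> f = \<one>\<^bsub>cochain_group p X\<^esub>"
  proof
    show "(\<lambda>c\<in>singular_chain_set p X. - f c) \<in> carrier (cochain_group p X)"
      using f by (auto simp: carrier_cochain_group singular_chain_add)
  qed (auto simp: mult_cochain_group one_cochain_group)
  show "\<one>\<^bsub>cochain_group p X\<^esub> \<otimes>\<^bsub>cochain_group p X\<^esub> f = f"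
    using f by (auto simp: carrier_cochain_group mult_cochain_group one_cochain_group
        extensional_def fun_eq_iff)
qed (auto simp: carrier_cochain_group mult_cochain_group one_cochain_group singular_chain_add
    intro!: restrict_ext)

lemma group_cochain_group: "group (cochain_group p X)"
  by (rule comm_group.axioms(2) [OF comm_group_cochain_group])

lemma cochain_zero:
  assumes "f \<in> carrier (cochain_group p X)" shows "f 0 = 0"
proof -
  have "f (0 + 0) = f 0 + f 0"
    using assms unfolding carrier_cochain_group by blast
  then show ?thesis by simp
qed

lemma cochain_minus:
  assumes f: "f \<in> carrier (cochain_group p X)" and c: "singular_chain p X c"
  shows "f (- c) = - f c"
proof -
  have "f (- c + c) = f (- c) + f c"
    using f c unfolding carrier_cochain_group by (metis singular_chain_minus)
  then show ?thesis
    using cochain_zero [OF f] by simp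
qed

lemma cochain_diff:
  assumes "f \<in> carrier (cochain_group p X)" "singular_chain p X a" "singular_chain p X b"
  shows "f (a - b) = f a - f b"
proof -
  have "f (a + - b) = f a + f (- b)"
    using assms unfolding carrier_cochain_group by (metis singular_chain_minus)
  then show ?thesis
    by (simp add: cochain_minus [OF assms(1,3)])
qed

lemma coboundary_apply:
  "singular_chain (Suc p) X c \<Longrightarrow> coboundary p X f c = f (chain_boundary (Suc p) c)"
  by (simp add: coboundary_def)

lemma coboundary_hom:
  "coboundary p X \<in> hom (cochain_group p X) (cochain_group (Suc p) X)"
proof (rule homI)
  show "coboundary p X f \<in> carrier (cochain_group (Suc p) X)"
    if "f \<in> carrier (cochain_group p X)" for f
    using that unfolding carrier_cochain_group
    by (simp add: coboundary_def chain_boundary_add singular_chain_add singular_chain_boundary_alt)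
  show "coboundary p X (f \<otimes>\<^bsub>cochain_group p X\<^esub> g) =
      coboundary p X f \<otimes>\<^bsub>cochain_group (Suc p) X\<^esub> coboundary p X g" for f g
    by (auto simp: coboundary_def mult_cochain_group singular_chain_boundary_alt intro!: restrict_ext)
qed

lemma group_hom_coboundary:
  "group_hom (cochain_group p X) (cochain_group (Suc p) X) (coboundary p X)"
  by (simp add: group_hom_def group_hom_axioms_def group_cochain_group coboundary_hom)

lemma subgroup_cocycles:
  "subgroup (kernel (cochain_group p X) (cochain_group (Suc p) X) (coboundary p X)) (cochain_group p X)"
  by (rule group_hom.subgroup_kernel [OF group_hom_coboundary])

lemma carrier_cocycle_group:
  "carrier (cocycle_group p X) =
     {f \<in> carrier (cochain_group p X).
        \<forall>c. singular_chain (Suc p) X c \<longrightarrow> f (chain_boundary (Suc p) c) = 0}"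
proof -
  have "carrier (cocycle_group p X) =
      kernel (cochain_group p X) (cochain_group (Suc p) X) (coboundary p X)"
    unfolding cocycle_group_def
    by (rule subgroup.carrier_subgroup_generated_subgroup [OF subgroup_cocycles])
  also have "\<dots> = {f \<in> carrier (cochain_group p X).
        \<forall>c. singular_chain (Suc p) X c \<longrightarrow> f (chain_boundary (Suc p) c) = 0}"
    by (auto simp: kernel_def one_cochain_group coboundary_def fun_eq_iff restrict_def split: if_splits)
  finally show ?thesis .
qed

lemma mult_cocycle_group: "f \<otimes>\<^bsub>cocycle_group p X\<^esub> g = f \<otimes>\<^bsub>cochain_group p X\<^esub> g"
  by (simp add: cocycle_group_def)

lemma one_cocycle_group: "\<one>\<^bsub>cocycle_group p X\<^esub> = \<one>\<^bsub>cochain_group p X\<^esub>"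
  by (simp add: cocycle_group_def)

lemma comm_group_cocycle_group: "comm_group (cocycle_group p X)"
  unfolding cocycle_group_def
  by (rule group.abelian_subgroup_generated)
     (auto simp: group_cochain_group comm_group_cochain_group)

lemma subgroup_coboundary_set: "subgroup (coboundary_set p X) (cocycle_group p X)"
proof -
  interpret G: group "cochain_group p X" by (rule group_cochain_group)
  have "subgroup (coboundary_set p X) (cochain_group p X)"
  proof (cases p)
    case 0
    then show ?thesis
      using G.triv_subgroup by (simp add: coboundary_set_def)
  next
    case (Suc q)
    then show ?thesis
      using group_hom.img_is_subgroup [OF group_hom_coboundary [of q X]]
      by (simp add: coboundary_set_def)
  qed
  moreover have "coboundary_set p X \<subseteq> carrier (cocycle_group p X)"
  proof (cases p)
    case 0
    then show ?thesis
      using comm_group.axioms(2) [OF comm_group_cocycle_group [of 0 X]]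
      by (simp add: coboundary_set_def one_cocycle_group [symmetric] group.is_monoid monoid.one_closed)
  next
    case (Suc q)
    have "coboundary q X f (chain_boundary (Suc p) c) = 0"
      if "f \<in> carrier (cochain_group q X)" "singular_chain (Suc p) X c" for f c
      using that Suc by (metis coboundary_apply singular_chain_boundary_alt chain_boundary_boundary_alt
          cochain_zero)
    then show ?thesis
      using Suc hom_carrier [OF coboundary_hom [of q X]]
      by (auto simp: coboundary_set_def carrier_cocycle_group)
  qed
  ultimately show ?thesis
    unfolding cocycle_group_def
    by (metis subgroup.carrier_subgroup_generated_subgroup G.subgroup_of_subgroup_generated subgroup_cocycles)
qed

lemma group_cohomology_group: "group (cohomology_group p X)"
  unfolding cohomology_group_def
  by (simp add: normal.factorgroup_is_group comm_group.normal_iff_subgroup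
      comm_group_cocycle_group subgroup_coboundary_set)

lemma one_cohomology_group: "\<one>\<^bsub>cohomology_group p X\<^esub> = coboundary_set p X"
  by (simp add: cohomology_group_def FactGroup_def)

section \<open>Degree 0: cocycles as functions on points\<close>

text \<open>The only coboundary in degree 0 is the zero cochain, so cosets are singletons and
  classes can be handled as cocycles.\<close>

lemma coset_0_cocycle:
  assumes "f \<in> carrier (cocycle_group 0 X)"
  shows "coboundary_set 0 X #>\<^bsub>cocycle_group 0 X\<^esub> f = {f}"
proof -
  interpret G: comm_group "cocycle_group 0 X" by (rule comm_group_cocycle_group)
  show ?thesis
    using assms by (simp add: coboundary_set_def r_coset_def one_cocycle_group [symmetric])
qed

lemma carrier_cohomology_group_0:
  "carrier (cohomology_group 0 X) = (\<lambda>f. {f}) ` carrier (cocycle_group 0 X)"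
  by (auto simp: cohomology_group_def FactGroup_def RCOSETS_def coset_0_cocycle)

lemma mult_cohomology_group_0:
  "{f} \<otimes>\<^bsub>cohomology_group 0 X\<^esub> {g} = {f \<otimes>\<^bsub>cocycle_group 0 X\<^esub> g}"
  by (simp add: cohomology_group_def FactGroup_def set_mult_def)

text \<open>All \<open>p + 1\<close> faces of a constant simplex coincide, so the alternating sum
  cancels for odd \<open>p\<close> and leaves one copy for even \<open>p > 0\<close>. The boundary
  map does not refer to a space, so the computation may be done in the one-point space
  \<open>{a}\<close>.\<close>

lemma chain_boundary_constant:
  "chain_boundary p (frag_of (\<lambda>x\<in>standard_simplex p. a)) =
     (if p = 0 \<or> odd p then 0 else frag_of (\<lambda>x\<in>standard_simplex (p - 1). a))"
proof -
  have "topspace (discrete_topology {a}) = {a}" by simp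
  moreover from this have "singular_chain p (discrete_topology {a}) (frag_of (\<lambda>x\<in>standard_simplex p. a))"
    using singular_simplex_singleton by (metis singular_chain_of)
  ultimately show ?thesis
    by (subst chain_boundary_of_singleton) auto
qed

lemma simplicial_vertex_constant: "simplicial_vertex 0 (\<lambda>x\<in>standard_simplex p. a) = a"
  by (simp add: simplicial_vertex_def)

lemma function_cochain_of:
  "singular_simplex 0 X \<sigma> \<Longrightarrow> function_cochain X f (frag_of \<sigma>) = f (simplicial_vertex 0 \<sigma>)"
  by (simp add: function_cochain_def singular_chain_of)

lemma function_cochain_in_cochain_group: "function_cochain X f \<in> carrier (cochain_group 0 X)"
proof -
  have "(\<Sum>\<sigma>\<in>Poly_Mapping.keys (a + b). Poly_Mapping.lookup (a + b) \<sigma> * f (simplicial_vertex 0 \<sigma>)) =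
      (\<Sum>\<sigma>\<in>Poly_Mapping.keys a. Poly_Mapping.lookup a \<sigma> * f (simplicial_vertex 0 \<sigma>)) +
      (\<Sum>\<sigma>\<in>Poly_Mapping.keys b. Poly_Mapping.lookup b \<sigma> * f (simplicial_vertex 0 \<sigma>))" for a b :: "'a chain"
    by (rule setsum_keys_plus_distrib) (auto simp: distrib_right)
  then show ?thesis
    by (auto simp: carrier_cochain_group function_cochain_def singular_chain_add)
qed

text \<open>The boundary of a 1-simplex is its vertex 1 minus its vertex 0, so agreement at the two
  ends of every path is what the cocycle condition asks for.\<close>

lemma function_cochain_in_cocycle_group:
  assumes "\<And>\<sigma>. singular_simplex 1 X \<sigma> \<Longrightarrow> f (simplicial_vertex 0 \<sigma>) = f (simplicial_vertex 1 \<sigma>)"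
  shows "function_cochain X f \<in> carrier (cocycle_group 0 X)"
proof -
  have vertices: "simplicial_vertex 0 (singular_face 1 0 \<sigma>) = simplicial_vertex 1 \<sigma>"
    "simplicial_vertex 0 (singular_face 1 1 \<sigma>) = simplicial_vertex 0 \<sigma>" for \<sigma> :: "(nat \<Rightarrow> real) \<Rightarrow> 'a"
    by (auto simp: simplicial_vertex_def singular_face_def simplical_face_def intro!: arg_cong [of _ _ \<sigma>])
  have "function_cochain X f (chain_boundary 1 c) = 0" if c: "singular_chain 1 X c" for c
  proof -
    have "singular_chain 1 X c \<and> function_cochain X f (chain_boundary 1 c) = 0"
      using c [unfolded singular_chain_def]
    proof (induction c rule: frag_induction)
      case zero
      show ?case
        using cochain_zero [OF function_cochain_in_cochain_group] by simp
    next
      case (one \<sigma>)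
      then have s: "singular_simplex 0 X (singular_face 1 0 \<sigma>)" "singular_simplex 0 X (singular_face 1 1 \<sigma>)"
        using singular_simplex_singular_face [of 1 X \<sigma>] by auto
      have "chain_boundary 1 (frag_of \<sigma>) = frag_of (singular_face 1 0 \<sigma>) - frag_of (singular_face 1 1 \<sigma>)"
        by (simp add: chain_boundary_of)
      then have "function_cochain X f (chain_boundary 1 (frag_of \<sigma>)) =
          f (simplicial_vertex 1 \<sigma>) - f (simplicial_vertex 0 \<sigma>)"
        using s vertices
        by (simp add: cochain_diff [OF function_cochain_in_cochain_group] singular_chain_of function_cochain_of
            del: One_nat_def)
      then show ?case
        using assms one by (auto simp: singular_chain_of)
    next
      case (diff a b)
      then have "singular_chain 0 X (chain_boundary 1 a)" "singular_chain 0 X (chain_boundary 1 b)"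
        by (auto intro: singular_chain_boundary_alt)
      with diff show ?case
        by (simp add: chain_boundary_diff cochain_diff [OF function_cochain_in_cochain_group] singular_chain_diff)
    qed
    then show ?thesis ..
  qed
  then show ?thesis
    by (simp add: carrier_cocycle_group function_cochain_in_cochain_group)
qed

lemma constant_0_simplex:
  assumes "singular_simplex 0 X \<sigma>"
  shows "(\<lambda>x\<in>standard_simplex 0. simplicial_vertex 0 \<sigma>) = \<sigma>"
proof
  fix t
  show "(\<lambda>x\<in>standard_simplex 0. simplicial_vertex 0 \<sigma>) t = \<sigma> t"
    using assms by (cases "t \<in> standard_simplex 0")
      (simp_all add: singular_simplex_def extensional_def simplicial_vertex_def standard_simplex_0)
qed

text \<open>A 0-simplex is the same as a point, and a cochain is determined by its values on
  simplices. No continuity is involved yet.\<close>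

lemma cochain_0_eq_function_cochain:
  assumes f: "f \<in> carrier (cochain_group 0 X)"
  shows "f = function_cochain X (\<lambda>x. f (frag_of (\<lambda>t\<in>standard_simplex 0. x)))" (is "f = ?g")
proof
  fix c
  have g: "?g \<in> carrier (cochain_group 0 X)"
    by (rule function_cochain_in_cochain_group)
  show "f c = ?g c"
  proof (cases "singular_chain 0 X c")
    case True
    have "singular_chain 0 X c \<and> f c = ?g c"
      using True [unfolded singular_chain_def]
    proof (induction c rule: frag_induction)
      case zero
      then show ?case using cochain_zero [OF f] cochain_zero [OF g] by (simp del: restrict_apply)
    next
      case (one \<sigma>)
      then show ?case
        using function_cochain_of [of X \<sigma>] constant_0_simplex [of X \<sigma>]
        by (simp add: singular_chain_of del: restrict_apply)
    next
      case (diff a b)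
      then show ?case
        using cochain_diff [OF f, of a b] cochain_diff [OF g, of a b] singular_chain_diff [of 0 X a b]
        by (simp del: restrict_apply)
    qed
    then show ?thesis ..
  next
    case False
    then show ?thesis
      using f g by (simp add: carrier_cochain_group extensional_def)
  qed
qed

lemma function_cochain_eq_iff:
  "function_cochain X f = function_cochain X g \<longleftrightarrow> (\<forall>x\<in>topspace X. f x = g x)"
proof
  assume eq: "function_cochain X f = function_cochain X g"
  show "\<forall>x\<in>topspace X. f x = g x"
  proof
    fix x assume "x \<in> topspace X"
    then have "singular_simplex 0 X (\<lambda>t\<in>standard_simplex 0. x)"
      by (simp add: singular_simplex_def)
    from function_cochain_of [OF this, of f] function_cochain_of [OF this, of g] show "f x = g x"
      unfolding simplicial_vertex_constant eq by simp
  qed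
next
  assume "\<forall>x\<in>topspace X. f x = g x"
  moreover have "simplicial_vertex 0 \<sigma> \<in> topspace X" if "singular_chain 0 X c" "\<sigma> \<in> Poly_Mapping.keys c" for c \<sigma>
    using that by (auto simp: singular_chain_def singular_simplex_def simplicial_vertex_def
        continuous_map_def Pi_iff)
  ultimately show "function_cochain X f = function_cochain X g"
    unfolding function_cochain_def by (auto intro!: restrict_ext sum.cong)
qed

lemma function_cochain_add:
  "function_cochain X (\<lambda>x. f x + g x) =
     function_cochain X f \<otimes>\<^bsub>cocycle_group 0 X\<^esub> function_cochain X g"
  unfolding mult_cocycle_group mult_cochain_group function_cochain_def
  by (auto intro!: restrict_ext simp: distrib_left sum.distrib)

lemma function_cochain_zero: "function_cochain X (\<lambda>x. 0) = \<one>\<^bsub>cochain_group 0 X\<^esub>"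
  by (simp add: function_cochain_def one_cochain_group)

section \<open>Cohomology of a space homotopic to a discrete set of values\<close>

text \<open>These two assumptions are all that the computation of the cohomology uses. The second
  expresses that \<open>r\<close> is constant on path components, in the form in which it is applied
  to chains.\<close>

locale homotopically_discrete =
  fixes X :: "'a topology" and r :: "'a \<Rightarrow> 'a"
  assumes homotopic_id: "homotopic_with (\<lambda>_. True) X X id r"
    and constant_on_simplex:
      "\<lbrakk>singular_simplex p X \<sigma>; t \<in> standard_simplex p; u \<in> standard_simplex p\<rbrakk> \<Longrightarrow> r (\<sigma> t) = r (\<sigma> u)"
begin

lemma continuous_r: "continuous_map X X r"
  using homotopic_with_imp_continuous_maps [OF homotopic_id] by simp

lemma simplex_map_r:
  assumes "singular_simplex p X \<sigma>"
  shows "simplex_map p r \<sigma> = (\<lambda>x\<in>standard_simplex p. r (simplicial_vertex 0 \<sigma>))"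
  unfolding simplex_map_def simplicial_vertex_def
  by (rule restrict_ext) (auto intro: constant_on_simplex [OF assms])

lemma constant_simplex:
  assumes "singular_simplex p X \<sigma>"
  shows "singular_simplex q X (\<lambda>x\<in>standard_simplex q. r (simplicial_vertex 0 \<sigma>))"
proof -
  have "simplicial_vertex 0 \<sigma> \<in> topspace X"
    using assms by (auto simp: singular_simplex_def simplicial_vertex_def continuous_map_def Pi_iff)
  then have "r (simplicial_vertex 0 \<sigma>) \<in> topspace X"
    using continuous_r by (auto simp: continuous_map_def)
  then show ?thesis
    by (simp add: singular_simplex_def)
qed

text \<open>Homotopic maps send a cycle to homologous cycles. In degree 0 every chain is a cycle, so
  there this applies to a single simplex as well.\<close>

lemma homologous_chain_map_r:
  assumes "singular_relcycle p X {} c"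
  shows "\<exists>d. singular_chain (Suc p) X d \<and> chain_boundary (Suc p) d = c - chain_map p r c"
proof -
  have "homotopic_with (\<lambda>h. h \<in> {} \<rightarrow> {}) X X id r"
    using homotopic_id by simp
  then have "homologous_rel p X {} (chain_map p id c) (chain_map p r c)"
    using assms by (rule homotopic_imp_homologous_rel_chain_maps)
  moreover have "chain_map p id c = c"
    using assms by (intro chain_map_id_gen) (auto simp: singular_cycle)
  ultimately show ?thesis
    by (simp add: homologous_rel_def singular_boundary)
qed

text \<open>The image under \<open>r\<close> is a combination of constant simplices. For odd
  \<open>p\<close> each of them is the boundary of the constant simplex one dimension higher. For
  even \<open>p\<close> the boundary map is injective on such combinations, so the image of a cycle
  is already 0.\<close>

lemma chain_map_r_boundary:
  assumes p: "p > 0" and c: "singular_relcycle p X {} c"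
  shows "\<exists>d. singular_chain (Suc p) X d \<and> chain_boundary (Suc p) d = chain_map p r c"
proof -
  have sc: "singular_chain p X c" and bc: "chain_boundary p c = 0"
    using c by (auto simp: singular_cycle)
  show ?thesis
  proof (cases "odd p")
    case True
    let ?D = "frag_extend (\<lambda>\<sigma>. frag_of (\<lambda>x\<in>standard_simplex (Suc p). r (simplicial_vertex 0 \<sigma>)))"
    have "singular_chain (Suc p) X (?D c)"
      using sc by (intro singular_chain_extend) (auto simp: singular_chain_def intro: constant_simplex)
    moreover have "chain_boundary (Suc p) (?D c) = chain_map p r c"
      using sc unfolding singular_chain_def
    proof (induction c rule: frag_induction)
      case (one \<sigma>)
      then show ?case
        using True chain_boundary_constant [of "Suc p" "r (simplicial_vertex 0 \<sigma>)"]
        by (simp add: simplex_map_r del: restrict_apply)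
    next
      case (diff a b)
      then show ?case
        by (simp add: frag_extend_diff chain_boundary_diff chain_map_diff)
    qed auto
    ultimately show ?thesis by blast
  next
    case False
    \<comment> \<open>A left inverse of the boundary on constant chains: it rebuilds the constant
      \<open>p\<close>-simplex from the vertex of its face.\<close>
    let ?T = "frag_extend (\<lambda>\<tau>. frag_of (\<lambda>x\<in>standard_simplex p. simplicial_vertex 0 \<tau>))"
    have "?T (chain_boundary p (chain_map p r c)) = chain_map p r c"
      using sc unfolding singular_chain_def
    proof (induction c rule: frag_induction)
      case (one \<sigma>)
      then show ?case
        using p False
        by (simp add: chain_boundary_constant simplex_map_r simplicial_vertex_constant del: restrict_apply)
    next
      case (diff a b)
      then show ?case
        by (simp add: frag_extend_diff chain_boundary_diff chain_map_diff)
    qed auto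
    moreover have "chain_boundary p (chain_map p r c) = 0"
      using chain_boundary_chain_map [OF sc, of r] bc by simp
    ultimately have "chain_map p r c = 0" by simp
    then show ?thesis
      by (intro exI [of _ 0]) auto
  qed
qed

lemma cycle_is_boundary:
  assumes "p > 0" "singular_chain p X c" "chain_boundary p c = 0"
  shows "\<exists>d. singular_chain (Suc p) X d \<and> chain_boundary (Suc p) d = c"
proof -
  have c: "singular_relcycle p X {} c"
    using assms by (simp add: singular_cycle)
  obtain d e where "singular_chain (Suc p) X d" "chain_boundary (Suc p) d = c - chain_map p r c"
    "singular_chain (Suc p) X e" "chain_boundary (Suc p) e = chain_map p r c"
    using homologous_chain_map_r [OF c] chain_map_r_boundary [OF assms(1) c] by metis
  then show ?thesis
    by (intro exI [of _ "d + e"]) (auto simp: chain_boundary_add singular_chain_add)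
qed

text \<open>The section \<open>K\<close> of the boundary map is built degree by degree: the defect
  \<open>\<sigma> - K (\<partial>\<sigma>)\<close> of the previous one is a cycle, so it has a preimage under the boundary map.\<close>

lemma boundary_section:
  "\<exists>K. (\<forall>\<sigma>. singular_simplex p X \<sigma> \<longrightarrow> singular_chain (Suc p) X (K \<sigma>)) \<and>
     (\<forall>c. singular_chain (Suc p) X c \<longrightarrow>
        chain_boundary (Suc p) (frag_extend K (chain_boundary (Suc p) c)) = chain_boundary (Suc p) c)"
proof (induction p)
  case 0
  \<comment> \<open>In degree 0 the section is the homotopy itself:
    \<open>\<partial> (K \<sigma>)\<close> is \<open>\<sigma>\<close> minus its image under
    \<open>r\<close>.\<close>
  have "\<exists>d. singular_chain (Suc 0) X d \<and>
      chain_boundary (Suc 0) d = frag_of \<sigma> - chain_map 0 r (frag_of \<sigma>)" if "singular_simplex 0 X \<sigma>" for \<sigma>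
  proof (rule homologous_chain_map_r)
    show "singular_relcycle 0 X {} (frag_of \<sigma>)"
      using that by (simp add: singular_cycle singular_chain_of chain_boundary_def)
  qed
  then obtain K where K: "\<And>\<sigma>. singular_simplex 0 X \<sigma> \<Longrightarrow> singular_chain (Suc 0) X (K \<sigma>)"
    "\<And>\<sigma>. singular_simplex 0 X \<sigma> \<Longrightarrow>
       chain_boundary (Suc 0) (K \<sigma>) = frag_of \<sigma> - chain_map 0 r (frag_of \<sigma>)"
    by metis
  have ext: "chain_boundary (Suc 0) (frag_extend K c) = c - chain_map 0 r c" if "singular_chain 0 X c" for c
    using that unfolding singular_chain_def
  proof (induction c rule: frag_induction)
    case (one \<sigma>)
    then show ?case using K(2) by simp
  next
    case (diff a b)
    then show ?case
      by (simp add: frag_extend_diff chain_boundary_diff chain_map_diff)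
  qed auto
  \<comment> \<open>The two ends of a path have the same image under \<open>r\<close>, so the
    correction term of \<open>K\<close> vanishes on boundaries.\<close>
  have const: "chain_boundary (Suc 0) (chain_map (Suc 0) r c) = 0" if "singular_chain (Suc 0) X c" for c
    using that unfolding singular_chain_def
  proof (induction c rule: frag_induction)
    case (one \<sigma>)
    then show ?case by (simp add: simplex_map_r chain_boundary_constant)
  next
    case (diff a b)
    then show ?case
      by (simp add: chain_boundary_diff chain_map_diff)
  qed auto
  have "chain_boundary (Suc 0) (frag_extend K (chain_boundary (Suc 0) c)) = chain_boundary (Suc 0) c"
    if c: "singular_chain (Suc 0) X c" for c
    using ext [OF singular_chain_boundary_alt [OF c]] const [OF c] chain_boundary_chain_map [OF c, of r]
    by simp
  with K(1) show ?case by blast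
next
  case (Suc p)
  then obtain K where K: "\<And>\<sigma>. singular_simplex p X \<sigma> \<Longrightarrow> singular_chain (Suc p) X (K \<sigma>)"
    "\<And>c. singular_chain (Suc p) X c \<Longrightarrow>
       chain_boundary (Suc p) (frag_extend K (chain_boundary (Suc p) c)) = chain_boundary (Suc p) c"
    by metis
  have "\<exists>d. singular_chain (Suc (Suc p)) X d \<and>
      chain_boundary (Suc (Suc p)) d = frag_of \<sigma> - frag_extend K (chain_boundary (Suc p) (frag_of \<sigma>))"
    if "singular_simplex (Suc p) X \<sigma>" for \<sigma>
  proof (rule cycle_is_boundary)
    have \<sigma>: "singular_chain (Suc p) X (frag_of \<sigma>)"
      using that by (simp add: singular_chain_of)
    then show "singular_chain (Suc p) X (frag_of \<sigma> - frag_extend K (chain_boundary (Suc p) (frag_of \<sigma>)))"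
      using singular_chain_boundary_alt [OF \<sigma>]
      by (intro singular_chain_diff singular_chain_extend K(1)) (auto simp: singular_chain_def [of p])
    show "chain_boundary (Suc p) (frag_of \<sigma> - frag_extend K (chain_boundary (Suc p) (frag_of \<sigma>))) = 0"
      using K(2) [OF \<sigma>] by (simp add: chain_boundary_diff)
  qed simp
  then obtain L where L: "\<And>\<sigma>. singular_simplex (Suc p) X \<sigma> \<Longrightarrow> singular_chain (Suc (Suc p)) X (L \<sigma>)"
    "\<And>\<sigma>. singular_simplex (Suc p) X \<sigma> \<Longrightarrow> chain_boundary (Suc (Suc p)) (L \<sigma>) =
       frag_of \<sigma> - frag_extend K (chain_boundary (Suc p) (frag_of \<sigma>))"
    by metis
  have ext: "chain_boundary (Suc (Suc p)) (frag_extend L c) =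
      c - frag_extend K (chain_boundary (Suc p) c)" if "singular_chain (Suc p) X c" for c
    using that unfolding singular_chain_def
  proof (induction c rule: frag_induction)
    case (one \<sigma>)
    then show ?case using L(2) by simp
  next
    case (diff a b)
    then show ?case
      by (simp add: frag_extend_diff chain_boundary_diff)
  qed auto
  have "chain_boundary (Suc (Suc p)) (frag_extend L (chain_boundary (Suc (Suc p)) c)) =
      chain_boundary (Suc (Suc p)) c" if c: "singular_chain (Suc (Suc p)) X c" for c
    using ext [OF singular_chain_boundary_alt [OF c]] chain_boundary_boundary_alt [OF c] by simp
  with L(1) show ?case by blast
qed

text \<open>With \<open>g = f \<circ> K\<close>: the chain \<open>c - K (\<partial> c)\<close> is a
  cycle, hence a boundary, and \<open>f\<close> vanishes on it. So
  \<open>f c = f (K (\<partial> c))\<close>, which is the coboundary of \<open>g\<close> at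
  \<open>c\<close>.\<close>

lemma cocycle_is_coboundary:
  assumes f: "f \<in> carrier (cocycle_group (Suc p) X)"
  shows "f \<in> coboundary_set (Suc p) X"
proof -
  have fc: "f \<in> carrier (cochain_group (Suc p) X)"
    and f0: "\<And>c. singular_chain (Suc (Suc p)) X c \<Longrightarrow> f (chain_boundary (Suc (Suc p)) c) = 0"
    using f by (auto simp: carrier_cocycle_group)
  obtain K where K: "\<And>\<sigma>. singular_simplex p X \<sigma> \<Longrightarrow> singular_chain (Suc p) X (K \<sigma>)"
    "\<And>c. singular_chain (Suc p) X c \<Longrightarrow>
       chain_boundary (Suc p) (frag_extend K (chain_boundary (Suc p) c)) = chain_boundary (Suc p) c"
    using boundary_section by metis
  define g where "g = (\<lambda>c\<in>singular_chain_set p X. f (frag_extend K c))"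
  have Kc: "singular_chain (Suc p) X (frag_extend K c)" if "singular_chain p X c" for c
    using that by (intro singular_chain_extend K(1)) (auto simp: singular_chain_def)
  have g: "g \<in> carrier (cochain_group p X)"
    using fc Kc by (auto simp: g_def carrier_cochain_group singular_chain_add frag_extend_add)
  have "f c = f (frag_extend K (chain_boundary (Suc p) c))" if c: "singular_chain (Suc p) X c" for c
  proof -
    let ?z = "c - frag_extend K (chain_boundary (Suc p) c)"
    have Kbc: "singular_chain (Suc p) X (frag_extend K (chain_boundary (Suc p) c))"
      using c by (simp add: Kc singular_chain_boundary_alt)
    have "\<exists>d. singular_chain (Suc (Suc p)) X d \<and> chain_boundary (Suc (Suc p)) d = ?z"
      using c Kbc K(2) by (intro cycle_is_boundary) (auto simp: singular_chain_diff chain_boundary_diff)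
    then have "f ?z = 0" using f0 by metis
    then show ?thesis by (simp add: cochain_diff [OF fc c Kbc])
  qed
  then have "f = coboundary p X g"
    using fc by (auto simp: coboundary_def g_def carrier_cochain_group extensional_def fun_eq_iff
        singular_chain_boundary_alt)
  with g show ?thesis by (simp add: coboundary_set_def)
qed

lemma carrier_cohomology_group_Suc:
  "carrier (cohomology_group (Suc p) X) = {\<one>\<^bsub>cohomology_group (Suc p) X\<^esub>}"
proof -
  interpret G: group "cocycle_group (Suc p) X"
    by (rule comm_group.axioms(2) [OF comm_group_cocycle_group])
  have "coboundary_set (Suc p) X #>\<^bsub>cocycle_group (Suc p) X\<^esub> f = coboundary_set (Suc p) X"
    if "f \<in> carrier (cocycle_group (Suc p) X)" for f
    by (rule G.coset_join2 [OF that subgroup_coboundary_set cocycle_is_coboundary [OF that]])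
  then show ?thesis
    using G.one_closed unfolding one_cohomology_group
    by (force simp: cohomology_group_def FactGroup_def RCOSETS_def)
qed

text \<open>The groups of positive degree are trivial, so the finite support demanded by the direct
  sum is automatic.\<close>

lemma carrier_total_cohomology:
  "y \<in> carrier (total_cohomology X) \<longleftrightarrow>
     y 0 \<in> carrier (cohomology_group 0 X) \<and> (\<forall>k>0. y k = \<one>\<^bsub>cohomology_group k X\<^esub>)"
proof -
  have triv: "carrier (cohomology_group k X) = {\<one>\<^bsub>cohomology_group k X\<^esub>}" if "k > 0" for k
    using that carrier_cohomology_group_Suc by (metis gr0_implies_Suc)
  have mem: "y \<in> carrier (total_cohomology X) \<longleftrightarrow> (\<forall>k. y k \<in> carrier (cohomology_group k X)) \<and>
      finite {k. y k \<noteq> \<one>\<^bsub>cohomology_group k X\<^esub>}"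
    unfolding total_cohomology_def carrier_sum_group [OF group_cohomology_group] by (simp add: PiE_iff)
  show ?thesis
  proof
    assume "y \<in> carrier (total_cohomology X)"
    then have "y k \<in> carrier (cohomology_group k X)" for k
      using mem by blast
    then show "y 0 \<in> carrier (cohomology_group 0 X) \<and> (\<forall>k>0. y k = \<one>\<^bsub>cohomology_group k X\<^esub>)"
      using triv by blast
  next
    assume y: "y 0 \<in> carrier (cohomology_group 0 X) \<and> (\<forall>k>0. y k = \<one>\<^bsub>cohomology_group k X\<^esub>)"
    then have "y k \<in> carrier (cohomology_group k X)" for k
      using triv by (cases "k = 0") auto
    moreover have "{k. y k \<noteq> \<one>\<^bsub>cohomology_group k X\<^esub>} \<subseteq> {0}"
      using y by auto
    ultimately show "y \<in> carrier (total_cohomology X)"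
      unfolding mem using finite_subset by blast
  qed
qed

text \<open>A 0-simplex and its image under \<open>r\<close> differ by a boundary, which a cocycle
  kills.\<close>

lemma cocycle_0_factors:
  assumes f: "f \<in> carrier (cocycle_group 0 X)" and \<sigma>: "singular_simplex 0 X \<sigma>"
  shows "f (frag_of \<sigma>) = f (frag_of (simplex_map 0 r \<sigma>))"
proof -
  have fc: "f \<in> carrier (cochain_group 0 X)"
    using f by (auto simp: carrier_cocycle_group)
  have c: "singular_relcycle 0 X {} (frag_of \<sigma>)"
    using \<sigma> by (simp add: singular_cycle singular_chain_of chain_boundary_def)
  have "f (frag_of \<sigma> - frag_of (simplex_map 0 r \<sigma>)) = 0"
    using homologous_chain_map_r [OF c] f by (auto simp: carrier_cocycle_group)
  then show ?thesis
    using cochain_diff [OF fc, of "frag_of \<sigma>" "frag_of (simplex_map 0 r \<sigma>)"] \<sigma> continuous_r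
    by (simp add: singular_chain_of singular_simplex_simplex_map)
qed

lemma cocycle_0_eq_function_cochain:
  assumes f: "f \<in> carrier (cocycle_group 0 X)"
  obtains F where "f = function_cochain X F" "\<And>x. x \<in> topspace X \<Longrightarrow> F x = F (r x)"
proof
  have fc: "f \<in> carrier (cochain_group 0 X)"
    using f by (auto simp: carrier_cocycle_group)
  let ?F = "\<lambda>x. f (frag_of (\<lambda>t\<in>standard_simplex 0. x))"
  show "f = function_cochain X ?F"
    by (rule cochain_0_eq_function_cochain [OF fc])
  fix x assume "x \<in> topspace X"
  then have \<sigma>: "singular_simplex 0 X (\<lambda>t\<in>standard_simplex 0. x)"
    by (simp add: singular_simplex_def)
  have "simplex_map 0 r (\<lambda>t\<in>standard_simplex 0. x) = (\<lambda>t\<in>standard_simplex 0. r x)"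
    using simplex_map_r [OF \<sigma>] by (simp add: simplicial_vertex_constant del: restrict_apply)
  then show "?F x = ?F (r x)"
    using cocycle_0_factors [OF f \<sigma>] by simp
qed

end

section \<open>The space\<close>

text \<open>Since \<open>phi (s * exp (s * t)) = - s * exp (- s * t)\<close> for \<open>s = \<plusminus>1\<close>, the coordinates
  \<open>s = sgn u\<close> and \<open>t = sgn u * ln \<bar>u\<bar>\<close> turn \<open>phi\<close> into a mere change of the sign \<open>s\<close>.\<close>

definition signed_ln :: "real \<Rightarrow> real" where
  "signed_ln u = sgn u * ln \<bar>u\<bar>"

definition signed_exp :: "real \<Rightarrow> real \<Rightarrow> real" where
  "signed_exp s t = s * exp (s * t)"

lemma signed_exp_ln: "u \<noteq> 0 \<Longrightarrow> signed_exp (sgn u) (signed_ln u) = u"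
  by (auto simp: signed_exp_def signed_ln_def sgn_if)

lemma sgn_signed_exp: "s = 1 \<or> s = - 1 \<Longrightarrow> sgn (signed_exp s t) = s"
  by (auto simp: signed_exp_def sgn_mult)

lemma signed_ln_exp: "s = 1 \<or> s = - 1 \<Longrightarrow> signed_ln (signed_exp s t) = t"
  by (auto simp: signed_exp_def signed_ln_def)

lemma phi_signed_exp: "s = 1 \<or> s = - 1 \<Longrightarrow> phi (signed_exp s t) = signed_exp (- s) t"
  by (auto simp: signed_exp_def phi_def power2_eq_square exp_minus field_simps)

text \<open>Both branches \<open>exp t\<close> and \<open>- exp (- t)\<close> increase with
  \<open>t\<close>, and the negative one lies below the positive one. The order of the reals thus
  becomes lexicographic in sign and logarithm.\<close>

lemma signed_exp_less_iff:
  assumes "s = 1 \<or> s = - 1" "s' = 1 \<or> s' = - 1"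
  shows "signed_exp s t < signed_exp s' t' \<longleftrightarrow> s < s' \<or> s = s' \<and> t < t'"
proof -
  have "- exp a < exp b" "\<not> exp a < - exp b" for a b :: real
    using exp_gt_zero [of a] exp_gt_zero [of b] by linarith+
  with assms show ?thesis
    by (auto simp: signed_exp_def)
qed

lemma signed_exp_pos_iff: "s = 1 \<or> s = - 1 \<Longrightarrow> 0 < signed_exp s t \<longleftrightarrow> s = 1"
  by (auto simp: signed_exp_def)

lemma sgn_cases: "(u::real) \<noteq> 0 \<Longrightarrow> sgn u = 1 \<or> sgn u = - 1"
  by (auto simp: sgn_if)

text \<open>Each value of \<open>signed_ln\<close> is taken once for either sign, and
  \<open>phi\<close> exchanges the two points. The two conditions
  \<open>x\<^sub>i \<noteq> x\<^sub>j\<close> and \<open>x\<^sub>i \<noteq> phi x\<^sub>j\<close>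
  therefore merge into one.\<close>

lemma signed_ln_eq_iff:
  assumes "u \<noteq> 0" "v \<noteq> 0"
  shows "signed_ln u = signed_ln v \<longleftrightarrow> u = v \<or> u = phi v"
proof -
  obtain s t s' t' where u: "u = signed_exp s t" "s = 1 \<or> s = - 1"
    and v: "v = signed_exp s' t'" "s' = 1 \<or> s' = - 1"
    using assms signed_exp_ln sgn_cases by metis
  have "s = s' \<or> s = - s'" using u v by auto
  then show ?thesis
    using u v by (metis phi_signed_exp signed_ln_exp minus_equation_iff)
qed

lemma Zspace_iff:
  "x \<in> Zspace \<longleftrightarrow> (\<forall>i. x $ i \<noteq> 0) \<and> (\<forall>i j. i \<noteq> j \<longrightarrow> signed_ln (x $ i) \<noteq> signed_ln (x $ j))"
  by (auto simp: Zspace_def signed_ln_eq_iff)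

section \<open>Signs and logarithms of barred and unbarred coordinates\<close>

fun index :: "'n signed \<Rightarrow> 'n" where
  "index (Plain i) = i"
| "index (Barred i) = i"

fun coord_sgn :: "real ^ 'n::finite \<Rightarrow> 'n signed \<Rightarrow> real" where
  "coord_sgn x (Plain i) = sgn (x $ i)"
| "coord_sgn x (Barred i) = - sgn (x $ i)"

lemma coord_sgn_cases: "x \<in> Zspace \<Longrightarrow> coord_sgn x u = 1 \<or> coord_sgn x u = - 1"
  using sgn_cases [of "x $ index u"] by (cases u) (auto simp: Zspace_iff)

lemma coord_sgn_bar: "coord_sgn x (bar u) = - coord_sgn x u"
  by (cases u) auto

lemma index_bar: "index (bar u) = index u"
  by (cases u) auto

text \<open>An index and its bar share the logarithm and have opposite signs, so all coordinates are
  read off from one sign vector and one vector of logarithms.\<close>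

lemma coord_eq:
  assumes "x \<in> Zspace"
  shows "coord x u = signed_exp (coord_sgn x u) (signed_ln (x $ index u))"
proof -
  have "x $ index u \<noteq> 0" using assms by (simp add: Zspace_iff)
  then show ?thesis
    using signed_exp_ln [of "x $ index u"] phi_signed_exp [OF sgn_cases [of "x $ index u"], of "signed_ln (x $ index u)"]
    by (cases u) auto
qed

lemma index_eq_imp: "index u = index w \<Longrightarrow> u = w \<or> u = bar w"
  by (cases u; cases w) auto

text \<open>Different underlying indices have different logarithms; for an index and its bar the
  signs differ.\<close>

lemma coord_distinct:
  assumes x: "x \<in> Zspace" and "u \<noteq> w"
  shows "coord x u \<noteq> coord x w"
proof
  assume "coord x u = coord x w"
  then have "coord_sgn x u = coord_sgn x w" "signed_ln (x $ index u) = signed_ln (x $ index w)"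
    using coord_sgn_cases [OF x] by (metis coord_eq [OF x] sgn_signed_exp signed_ln_exp)+
  then have "index u = index w" using x unfolding Zspace_iff by blast
  then have "u = bar w" using index_eq_imp assms(2) by blast
  then show False
    using \<open>coord_sgn x u = coord_sgn x w\<close> coord_sgn_cases [OF x, of w] by (auto simp: coord_sgn_bar)
qed

lemma zfun_ZZ:
  assumes "x \<in> Zspace"
  shows "zfun x (ZZ u w) = (if coord_sgn x u < coord_sgn x w \<or>
     coord_sgn x u = coord_sgn x w \<and> signed_ln (x $ index u) < signed_ln (x $ index w) then 1 else 0)"
  by (simp add: coord_eq [OF assms] signed_exp_less_iff coord_sgn_cases [OF assms])

lemma zfun_Z:
  assumes "x \<in> Zspace"
  shows "zfun x (Z u) = (if coord_sgn x u = 1 then 1 else 0)"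
  by (simp add: coord_eq [OF assms] signed_exp_pos_iff coord_sgn_cases [OF assms])

lemma ex_positive_signed:
  assumes "x \<in> Zspace"
  obtains u where "index u = i" "coord_sgn x u = 1"
  using coord_sgn_cases [OF assms, of "Plain i"] that [of "Plain i"] that [of "Barred i"] by auto

text \<open>Exactly one of \<open>Plain i\<close> and \<open>Barred i\<close> has a positive
  coordinate. Between two such positive representatives the comparison of coordinates is the
  comparison of logarithms, so it appears as the value of a variable \<open>ZZ u w\<close>.\<close>

lemma zfun_determines_order:
  assumes x: "x \<in> Zspace" and y: "y \<in> Zspace" and eq: "\<And>v. v \<in> zvars \<Longrightarrow> zfun x v = zfun y v"
  shows "sgn (x $ i) = sgn (y $ i)"
    and "signed_ln (x $ i) < signed_ln (x $ j) \<longleftrightarrow> signed_ln (y $ i) < signed_ln (y $ j)"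
proof -
  have sg: "coord_sgn x u = coord_sgn y u" for u
    using eq [of "Z u"] coord_sgn_cases [OF x, of u] coord_sgn_cases [OF y, of u]
    by (auto simp: zfun_Z x y zvars_def simp del: zfun.simps split: if_splits)
  show "sgn (x $ i) = sgn (y $ i)"
    using sg [of "Plain i"] by simp
  obtain u w where "index u = i" "coord_sgn x u = 1" "index w = j" "coord_sgn x w = 1"
    by (meson ex_positive_signed [OF x])
  then show "signed_ln (x $ i) < signed_ln (x $ j) \<longleftrightarrow> signed_ln (y $ i) < signed_ln (y $ j)"
    using eq [of "ZZ u w"] sg by (cases "u = w") (auto simp: zfun_ZZ x y zvars_def simp del: zfun.simps split: if_splits)
qed

text \<open>The total \<open>\<Sum>j. sgn (t\<^sub>i - t\<^sub>j)\<close> is a locally constant substitute for the rank of \<open>t\<^sub>i\<close>, so it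
  can be used as the target of a straight-line homotopy that never changes the order.\<close>

definition rank_sum :: "real ^ 'n::finite \<Rightarrow> 'n \<Rightarrow> real" where
  "rank_sum x i = (\<Sum>j\<in>UNIV. sgn (signed_ln (x $ i) - signed_ln (x $ j)))"

lemma rank_sum_less:
  assumes "signed_ln (x $ i) < signed_ln (x $ k)"
  shows "rank_sum x i < rank_sum x k"
  unfolding rank_sum_def
proof (rule sum_strict_mono_ex1)
  show "\<forall>j\<in>UNIV. sgn (signed_ln (x $ i) - signed_ln (x $ j)) \<le> sgn (signed_ln (x $ k) - signed_ln (x $ j))"
    using assms by (auto simp: sgn_if)
  \<comment> \<open>At \<open>j = i\<close> the left term is 0 and the right one is 1.\<close>
  show "\<exists>j\<in>UNIV. sgn (signed_ln (x $ i) - signed_ln (x $ j)) < sgn (signed_ln (x $ k) - signed_ln (x $ j))"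
    using assms by (intro bexI [of _ i]) auto
qed simp

definition straighten :: "real \<Rightarrow> real ^ 'n::finite \<Rightarrow> real ^ 'n" where
  "straighten s x =
     (\<chi> i. signed_exp (sgn (x $ i)) ((1 - s) * signed_ln (x $ i) + s * rank_sum x i))"

lemma straighten_0: "x \<in> Zspace \<Longrightarrow> straighten 0 x = x"
  by (simp add: straighten_def vec_eq_iff Zspace_iff signed_exp_ln)

lemma straighten_component:
  assumes "x \<in> Zspace"
  shows "sgn (straighten s x $ i) = sgn (x $ i)"
    and "signed_ln (straighten s x $ i) = (1 - s) * signed_ln (x $ i) + s * rank_sum x i"
proof -
  have "sgn (x $ i) = 1 \<or> sgn (x $ i) = - 1"
    using assms sgn_cases by (simp add: Zspace_iff)
  then show "sgn (straighten s x $ i) = sgn (x $ i)"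
    "signed_ln (straighten s x $ i) = (1 - s) * signed_ln (x $ i) + s * rank_sum x i"
    by (simp_all add: straighten_def sgn_signed_exp signed_ln_exp)
qed

text \<open>Both ends of the segment have the same order. The case \<open>s = 0\<close> is separate
  because strictness is taken from the rank term, which is absent there.\<close>

lemma straighten_order:
  assumes x: "x \<in> Zspace" and s: "0 \<le> s" "s \<le> 1"
    and less: "signed_ln (x $ i) < signed_ln (x $ j)"
  shows "signed_ln (straighten s x $ i) < signed_ln (straighten s x $ j)"
proof (cases "s = 0")
  case False
  then have "(1 - s) * signed_ln (x $ i) \<le> (1 - s) * signed_ln (x $ j)" "s * rank_sum x i < s * rank_sum x j"
    using s less rank_sum_less [OF less] by (auto intro!: mult_left_mono)
  then show ?thesis by (simp add: straighten_component [OF x])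
qed (use less in \<open>simp add: straighten_component [OF x]\<close>)

lemma straighten_in_Zspace:
  assumes x: "x \<in> Zspace" and s: "0 \<le> s" "s \<le> 1"
  shows "straighten s x \<in> Zspace"
proof -
  have "straighten s x $ i \<noteq> 0" for i
    using straighten_component(1) [OF x, of s i] x by (metis Zspace_iff sgn_zero_iff)
  moreover have "signed_ln (straighten s x $ i) \<noteq> signed_ln (straighten s x $ j)" if "i \<noteq> j" for i j
    using straighten_order [OF x s, of i j] straighten_order [OF x s, of j i] that x
    unfolding Zspace_iff by (metis less_irrefl linorder_less_linear)
  ultimately show ?thesis by (simp add: Zspace_iff)
qed

text \<open>At \<open>s = 1\<close> only the signs and \<open>rank_sum\<close> are left, and
  \<open>rank_sum\<close> depends on the order of the logarithms alone.\<close>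

lemma straighten_1_cong:
  assumes x: "x \<in> Zspace" and y: "y \<in> Zspace" and eq: "\<And>v. v \<in> zvars \<Longrightarrow> zfun x v = zfun y v"
  shows "straighten 1 x = straighten 1 y"
proof -
  have "sgn (signed_ln (x $ i) - signed_ln (x $ j)) = sgn (signed_ln (y $ i) - signed_ln (y $ j))" for i j
    using zfun_determines_order(2) [OF assms, of i j] zfun_determines_order(2) [OF assms, of j i]
    by (auto simp: sgn_if)
  then show ?thesis
    using zfun_determines_order(1) [OF assms] by (simp add: straighten_def rank_sum_def)
qed

section \<open>Continuity of the homotopy and constancy of \<open>zfun\<close> on connected
  sets\<close>

lemma continuous_on_signed_ln:
  assumes "continuous_on S f" "\<And>x. x \<in> S \<Longrightarrow> f x \<noteq> 0"
  shows "continuous_on S (\<lambda>x. signed_ln (f x))"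
  unfolding signed_ln_def using assms by (auto intro!: continuous_intros)

text \<open>\<open>sgn\<close> is continuous away from 0, and in \<open>Zspace\<close> the
  differences with \<open>j \<noteq> i\<close> never vanish; the term with \<open>j = i\<close> is
  constantly 0.\<close>

lemma continuous_on_rank_sum:
  "continuous_on (Zspace :: (real ^ 'n::finite) set) (\<lambda>x. rank_sum x i)"
proof -
  have "continuous_on Zspace (\<lambda>x :: real ^ 'n. sgn (signed_ln (x $ i) - signed_ln (x $ j)))" for j
  proof (cases "i = j")
    case False
    then show ?thesis
      by (intro continuous_on_sgn continuous_on_signed_ln continuous_intros) (auto simp: Zspace_iff)
  qed simp
  then show ?thesis
    unfolding rank_sum_def by (intro continuous_on_sum) auto
qed

lemma continuous_on_straighten:
  "continuous_on ({0..1} \<times> (Zspace :: (real ^ 'n::finite) set)) (\<lambda>(s, x). straighten s x)"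
proof -
  have "continuous_on ({0..1} \<times> Zspace) (\<lambda>p :: real \<times> (real ^ 'n). rank_sum (snd p) i)" for i
    by (rule continuous_on_compose2 [OF continuous_on_rank_sum]) (auto intro!: continuous_intros)
  then show ?thesis
    unfolding straighten_def signed_exp_def case_prod_unfold
    by (intro continuous_on_vec_lambda continuous_on_mult continuous_on_exp continuous_on_add
        continuous_on_sgn continuous_on_signed_ln continuous_intros) (auto simp: Zspace_iff)
qed

lemma continuous_on_coord: "continuous_on (Zspace :: (real ^ 'n::finite) set) (\<lambda>x. coord x u)"
  by (cases u) (auto simp: phi_def Zspace_iff intro!: continuous_intros)

lemma nonvanishing_sign_constant:
  fixes f :: "'a::topological_space \<Rightarrow> real"
  assumes C: "connected C" and f: "continuous_on C f" "\<And>x. x \<in> C \<Longrightarrow> f x \<noteq> 0"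
    and "a \<in> C" "b \<in> C"
  shows "0 < f a \<longleftrightarrow> 0 < f b"
proof -
  have "connected (f ` C)"
    by (rule connected_continuous_image [OF f(1) C])
  moreover have "0 \<notin> f ` C" using f(2) by auto
  ultimately have "\<not> (f c < 0 \<and> 0 < f d)" if "c \<in> C" "d \<in> C" for c d
    using that connectedD_interval [of "f ` C" "f c" "f d" 0] by auto
  then show ?thesis
    using assms(4,5) f(2) by (meson linorder_neqE_linordered_idom not_less_iff_gr_or_eq)
qed

lemma zfun_constant_on_connected:
  assumes C: "connected C" "C \<subseteq> Zspace" and "a \<in> C" "b \<in> C"
  shows "zfun a v = zfun b v"
proof (cases v)
  case (ZZ u w)
  show ?thesis
  \<comment> \<open>The symbols \<open>ZZ u u\<close> lie outside \<open>zvars\<close>, but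
    \<open>zfun\<close> has the value 0 there. Including them yields equality of
    \<open>zfun a\<close> and \<open>zfun b\<close> as whole functions.\<close>
  proof (cases "u = w")
    case False
    have "0 < coord a w - coord a u \<longleftrightarrow> 0 < coord b w - coord b u"
      by (rule nonvanishing_sign_constant [OF C(1) _ _ assms(3,4)])
         (use C(2) False coord_distinct in \<open>force intro!: continuous_intros
            continuous_on_subset [OF continuous_on_coord]\<close>)+
    then show ?thesis by (simp add: ZZ)
  qed (simp add: ZZ)
next
  case (Z u)
  have "coord x u \<noteq> 0" if "x \<in> Zspace" for x
    using coord_eq [OF that, of u] coord_sgn_cases [OF that, of u] by (auto simp: signed_exp_def)
  then have "0 < coord a u \<longleftrightarrow> 0 < coord b u"
    using C(2) by (intro nonvanishing_sign_constant [OF C(1) _ _ assms(3,4)])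
      (auto intro: continuous_on_subset [OF continuous_on_coord])
  then show ?thesis by (simp add: Z)
qed

lemma zfun_constant_on_simplex:
  assumes \<sigma>: "singular_simplex p (top_of_set Zspace) \<sigma>"
    and "t \<in> standard_simplex p" "u \<in> standard_simplex p"
  shows "zfun (\<sigma> t) v = zfun (\<sigma> u) v"
proof (rule zfun_constant_on_connected)
  have cont: "continuous_map (subtopology (powertop_real UNIV) (standard_simplex p)) (top_of_set Zspace) \<sigma>"
    using \<sigma> by (simp add: singular_simplex_def)
  then have "connectedin (top_of_set Zspace) (\<sigma> ` standard_simplex p)"
    by (rule connectedin_continuous_map_image)
       (simp add: connectedin_subtopology connectedin_standard_simplex)
  then show "connected (\<sigma> ` standard_simplex p)" "\<sigma> ` standard_simplex p \<subseteq> Zspace"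
    by (auto simp: connectedin_subtopology)
qed (use assms in auto)

lemma homotopically_discrete_Zspace:
  "homotopically_discrete (top_of_set (Zspace :: (real ^ 'n::finite) set)) (straighten 1)"
proof
  have "continuous_map (top_of_set ({0..1} \<times> Zspace)) (top_of_set (Zspace :: (real ^ 'n) set))
      (\<lambda>(s, x). straighten s x)"
    using continuous_on_straighten by (auto simp: straighten_in_Zspace)
  then have "homotopic_with (\<lambda>_. True) (top_of_set Zspace) (top_of_set (Zspace :: (real ^ 'n) set))
      (straighten 0) (straighten 1)"
    unfolding homotopic_with_def
    by (intro exI [of _ "\<lambda>(s, x). straighten s x"]) (auto simp: prod_topology_subtopology_eu)
  then show "homotopic_with (\<lambda>_. True) (top_of_set Zspace) (top_of_set (Zspace :: (real ^ 'n) set))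
      id (straighten 1)"
    by (rule homotopic_with_eq) (auto simp: straighten_0)
next
  fix p :: nat and \<sigma> :: "(nat \<Rightarrow> real) \<Rightarrow> real ^ 'n" and t u
  assume \<sigma>: "singular_simplex p (top_of_set Zspace) \<sigma>"
    and tu: "t \<in> standard_simplex p" "u \<in> standard_simplex p"
  have "\<sigma> t \<in> Zspace" "\<sigma> u \<in> Zspace"
    using \<sigma> tu by (auto simp: singular_simplex_def continuous_map_def Pi_iff)
  then show "straighten 1 (\<sigma> t) = straighten 1 (\<sigma> u)"
    by (rule straighten_1_cong) (rule zfun_constant_on_simplex [OF \<sigma> tu])
qed

section \<open>The polynomial ring\<close>

definition zvar :: "'n zvar \<Rightarrow> 'n zpoly" where
  "zvar v = Poly_Mapping.single (Poly_Mapping.single v 1) 1"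

lemma zz_eq_zvar: "zz i j = zvar (ZZ i j)" and z1_eq_zvar: "z1 i = zvar (Z i)"
  by (simp_all add: zz_def z1_def zvar_def)

lemma finite_zvars: "finite (zvars :: 'n::finite zvar set)"
proof -
  have "u \<in> range Plain \<union> range Barred" for u :: "'n signed"
    by (cases u) auto
  then have "finite (UNIV :: 'n signed set)"
    by (intro finite_subset [of UNIV "range Plain \<union> range Barred"]) auto
  then have "finite (case_prod ZZ ` (UNIV :: ('n signed \<times> 'n signed) set) \<union> range Z)"
    by (simp add: finite_Prod_UNIV)
  then show ?thesis
    by (rule rev_finite_subset) (auto simp: zvars_def)
qed

lemma zpoly_eval_add: "zpoly_eval a (p + q) = zpoly_eval a p + zpoly_eval a q"
  unfolding zpoly_eval_def
  by (rule setsum_keys_plus_distrib) (auto simp: distrib_right)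

lemma zpoly_eval_0: "zpoly_eval a 0 = 0"
  by (simp add: zpoly_eval_def)

lemma zpoly_eval_minus: "zpoly_eval a (- p) = - zpoly_eval a p"
  using zpoly_eval_add [of a p "- p"] by (simp add: zpoly_eval_0)

lemma zpoly_eval_diff: "zpoly_eval a (p - q) = zpoly_eval a p - zpoly_eval a q"
  using zpoly_eval_add [of a p "- q"] by (simp add: zpoly_eval_minus)

text \<open>\<open>frag_of m\<close> is the monomial \<open>m\<close> with coefficient 1:
  additively, polynomials are the free abelian group on monomials. This makes
  \<open>frag_induction\<close>, used above for chains, an induction over polynomials.\<close>

lemma zpoly_eval_monomial:
  "zpoly_eval a (frag_of m) = (\<Prod>v\<in>Poly_Mapping.keys m. a v ^ Poly_Mapping.lookup m v)"
  by (simp add: zpoly_eval_def)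

lemma zpoly_eval_monomial_superset:
  assumes "finite S" "Poly_Mapping.keys m \<subseteq> S"
  shows "zpoly_eval a (frag_of m) = (\<Prod>v\<in>S. a v ^ Poly_Mapping.lookup m v)"
  unfolding zpoly_eval_monomial
  by (rule prod.mono_neutral_left) (use assms in \<open>auto simp: in_keys_iff\<close>)

lemma zpoly_eval_monomial_mult:
  "zpoly_eval a (frag_of (m + m')) = zpoly_eval a (frag_of m) * zpoly_eval a (frag_of m')"
proof -
  let ?S = "Poly_Mapping.keys m \<union> Poly_Mapping.keys m'"
  show ?thesis
    using zpoly_eval_monomial_superset [of ?S "m + m'" a] zpoly_eval_monomial_superset [of ?S m a]
      zpoly_eval_monomial_superset [of ?S m' a] keys_add [of m m']
    by (simp add: lookup_add power_add prod.distrib)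
qed

text \<open>Both sides are biadditive, so two inductions reduce the claim to monomials; the set
  \<open>UNIV\<close> puts no restriction on these.\<close>

lemma zpoly_eval_mult: "zpoly_eval a (p * q) = zpoly_eval a p * zpoly_eval a q"
  using subset_UNIV [of "Poly_Mapping.keys p"]
proof (induction p rule: frag_induction)
  case (one m)
  show ?case
    using subset_UNIV [of "Poly_Mapping.keys q"]
  proof (induction q rule: frag_induction)
    case (one m')
    have "frag_of m * frag_of m' = frag_of (m + m')"
      by (simp add: mult_single)
    then show ?case by (simp add: zpoly_eval_monomial_mult)
  qed (simp_all add: zpoly_eval_0 zpoly_eval_diff right_diff_distrib)
qed (simp_all add: zpoly_eval_0 zpoly_eval_diff left_diff_distrib)

lemma zpoly_eval_1: "zpoly_eval a 1 = 1"
  by (simp add: zpoly_eval_def)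

lemma zpoly_eval_of_int: "zpoly_eval a (of_int k) = k"
proof -
  have "zpoly_eval a (of_nat n) = int n" for n
    by (induction n) (simp_all add: zpoly_eval_0 zpoly_eval_1 zpoly_eval_add)
  then show ?thesis
    by (cases k) (simp_all add: zpoly_eval_minus zpoly_eval_diff zpoly_eval_1)
qed

lemma zpoly_eval_sum: "zpoly_eval a (sum f A) = (\<Sum>x\<in>A. zpoly_eval a (f x))"
  by (induction A rule: infinite_finite_induct) (simp_all add: zpoly_eval_0 zpoly_eval_add)

lemma zpoly_eval_prod: "zpoly_eval a (prod f A) = (\<Prod>x\<in>A. zpoly_eval a (f x))"
  by (induction A rule: infinite_finite_induct) (simp_all add: zpoly_eval_1 zpoly_eval_mult)

lemma zpoly_eval_zvar: "zpoly_eval a (zvar v) = a v"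
  by (simp add: zpoly_eval_def zvar_def)

lemmas zpoly_eval_simps = zpoly_eval_0 zpoly_eval_1 zpoly_eval_add zpoly_eval_diff zpoly_eval_minus
  zpoly_eval_mult zpoly_eval_zvar zpoly_eval_of_int

text \<open>This form with a set of admissible monomials is the one to which
  \<open>frag_induction\<close> applies.\<close>

lemma carrier_zpoly_ring: "p \<in> carrier zpoly_ring \<longleftrightarrow> Poly_Mapping.keys p \<subseteq> {m. Poly_Mapping.keys m \<subseteq> zvars}"
  by (auto simp: zpoly_ring_def)

lemma zpoly_ring_simps [simp]:
  "\<zero>\<^bsub>zpoly_ring\<^esub> = 0" "\<one>\<^bsub>zpoly_ring\<^esub> = 1"
  "p \<oplus>\<^bsub>zpoly_ring\<^esub> q = p + q" "p \<otimes>\<^bsub>zpoly_ring\<^esub> q = p * q"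
  by (simp_all add: zpoly_ring_def)

lemma zpoly_eval_cong:
  assumes p: "p \<in> carrier zpoly_ring" and ab: "\<And>v. v \<in> zvars \<Longrightarrow> a v = b v"
  shows "zpoly_eval a p = zpoly_eval b p"
  unfolding zpoly_eval_def
proof (rule sum.cong [OF refl])
  fix m assume "m \<in> Poly_Mapping.keys p"
  then have "Poly_Mapping.keys m \<subseteq> zvars" using p by (auto simp: carrier_zpoly_ring)
  then have "(\<Prod>v\<in>Poly_Mapping.keys m. a v ^ Poly_Mapping.lookup m v) =
      (\<Prod>v\<in>Poly_Mapping.keys m. b v ^ Poly_Mapping.lookup m v)"
    by (intro prod.cong) (auto simp: ab)
  then show "Poly_Mapping.lookup p m * (\<Prod>v\<in>Poly_Mapping.keys m. a v ^ Poly_Mapping.lookup m v) =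
      Poly_Mapping.lookup p m * (\<Prod>v\<in>Poly_Mapping.keys m. b v ^ Poly_Mapping.lookup m v)"
    by simp
qed

lemma zpoly_carrier_0: "0 \<in> carrier zpoly_ring"
  and zpoly_carrier_1: "1 \<in> carrier zpoly_ring"
  by (simp_all add: carrier_zpoly_ring)

lemma zpoly_carrier_zvar: "v \<in> zvars \<Longrightarrow> zvar v \<in> carrier zpoly_ring"
  by (simp add: carrier_zpoly_ring zvar_def)

lemma zpoly_carrier_add: "\<lbrakk>p \<in> carrier zpoly_ring; q \<in> carrier zpoly_ring\<rbrakk> \<Longrightarrow> p + q \<in> carrier zpoly_ring"
  using keys_add [of p q] by (auto simp: carrier_zpoly_ring)

lemma zpoly_carrier_minus: "p \<in> carrier zpoly_ring \<Longrightarrow> - p \<in> carrier zpoly_ring"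
  by (simp add: carrier_zpoly_ring)

lemma zpoly_carrier_diff: "\<lbrakk>p \<in> carrier zpoly_ring; q \<in> carrier zpoly_ring\<rbrakk> \<Longrightarrow> p - q \<in> carrier zpoly_ring"
  using zpoly_carrier_add [of p "- q"] zpoly_carrier_minus [of q] by simp

lemma zpoly_carrier_mult:
  assumes "p \<in> carrier zpoly_ring" "q \<in> carrier zpoly_ring"
  shows "p * q \<in> carrier zpoly_ring"
proof -
  have "Poly_Mapping.keys m \<subseteq> zvars" if "m \<in> Poly_Mapping.keys (p * q)" for m
  proof -
    obtain b c where m: "m = b + c" and b: "b \<in> Poly_Mapping.keys p" and c: "c \<in> Poly_Mapping.keys q"
      using \<open>m \<in> Poly_Mapping.keys (p * q)\<close> keys_mult [of p q] by blast
    have "Poly_Mapping.keys b \<subseteq> zvars" "Poly_Mapping.keys c \<subseteq> zvars"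
      using b c assms by (auto simp: carrier_zpoly_ring)
    then show ?thesis
      using keys_add [of b c] m by blast
  qed
  then show ?thesis by (auto simp: carrier_zpoly_ring)
qed

lemma zpoly_carrier_of_int: "of_int k \<in> carrier zpoly_ring"
proof -
  have "of_nat n \<in> carrier zpoly_ring" for n
    by (induction n) (auto intro: zpoly_carrier_0 zpoly_carrier_1 zpoly_carrier_add)
  then show ?thesis
    by (cases k) (auto intro!: zpoly_carrier_1 zpoly_carrier_minus zpoly_carrier_diff simp del: of_nat_Suc)
qed

lemma zpoly_carrier_sum: "(\<And>x. x \<in> A \<Longrightarrow> f x \<in> carrier zpoly_ring) \<Longrightarrow> sum f A \<in> carrier zpoly_ring"
  by (induction A rule: infinite_finite_induct) (auto intro: zpoly_carrier_0 zpoly_carrier_add)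

lemma zpoly_carrier_prod: "(\<And>x. x \<in> A \<Longrightarrow> f x \<in> carrier zpoly_ring) \<Longrightarrow> prod f A \<in> carrier zpoly_ring"
  by (induction A rule: infinite_finite_induct) (auto intro: zpoly_carrier_1 zpoly_carrier_mult)

lemmas zpoly_carrier = zpoly_carrier_0 zpoly_carrier_1 zpoly_carrier_zvar zpoly_carrier_add
  zpoly_carrier_minus zpoly_carrier_diff zpoly_carrier_mult zpoly_carrier_of_int
  zpoly_carrier_sum zpoly_carrier_prod

lemma cring_zpoly_ring: "cring (zpoly_ring :: 'n zpoly ring)"
proof (rule cringI)
  show "abelian_group (zpoly_ring :: 'n zpoly ring)"
  proof (rule abelian_groupI)
    fix p :: "'n zpoly" assume "p \<in> carrier zpoly_ring"
    then show "\<exists>q\<in>carrier zpoly_ring. q \<oplus>\<^bsub>zpoly_ring\<^esub> p = \<zero>\<^bsub>zpoly_ring\<^esub>"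
      by (intro bexI [of _ "- p"]) (auto intro: zpoly_carrier)
  qed (auto intro: zpoly_carrier simp: ac_simps)
  show "Group.comm_monoid (zpoly_ring :: 'n zpoly ring)"
    by (rule comm_monoidI) (auto intro: zpoly_carrier simp: ac_simps)
qed (auto simp: distrib_right)

lemma monomial_eq_prod_zvar:
  "(frag_of m :: 'n zpoly) = (\<Prod>v\<in>Poly_Mapping.keys m. zvar v ^ Poly_Mapping.lookup m v)"
proof -
  have power: "zvar v ^ k = frag_of (Poly_Mapping.single v k)" for v :: "'n zvar" and k
    by (induction k) (simp_all add: zvar_def mult_single single_add [symmetric])
  have "(\<Prod>v\<in>A. frag_of (f v)) = (frag_of (sum f A) :: 'n zpoly)" if "finite A" for A and f :: "'n zvar \<Rightarrow> _"
    using that by (induction A) (simp_all add: mult_single)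
  moreover have "m = (\<Sum>v\<in>Poly_Mapping.keys m. Poly_Mapping.single v (Poly_Mapping.lookup m v))"
    by (rule poly_mapping_eqI) (simp add: lookup_sum lookup_single in_keys_iff when_def)
  ultimately show ?thesis
    unfolding power by (metis finite_keys)
qed

section \<open>The ideal of relations\<close>

lemma zrelations_carrier: "zrelations \<union> zswap \<subseteq> carrier zpoly_ring"
proof -
  have "zz i j \<in> carrier zpoly_ring" if "i \<noteq> j" for i j :: "'a signed"
    using that by (auto simp: zz_eq_zvar zvars_def intro!: zpoly_carrier)
  moreover have "z1 i \<in> carrier zpoly_ring" for i :: "'a signed"
    by (auto simp: z1_eq_zvar zvars_def intro!: zpoly_carrier)
  moreover have "bar i \<noteq> bar j" if "i \<noteq> j" for i j :: "'a signed"
    using that by (cases i; cases j) auto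
  ultimately show ?thesis
    unfolding zrelations_def zswap_def by (auto intro!: zpoly_carrier)
qed

lemma ideal_zideal: "ideal zideal zpoly_ring"
  unfolding zideal_def
  by (rule ring.genideal_ideal [OF cring.axioms(1) [OF cring_zpoly_ring] zrelations_carrier])

lemma zideal_carrier: "p \<in> zideal \<Longrightarrow> p \<in> carrier zpoly_ring"
  by (rule ideal.Icarr [OF ideal_zideal])

lemma zideal_relation: "p \<in> zrelations \<union> zswap \<Longrightarrow> p \<in> zideal"
  unfolding zideal_def
  using ring.genideal_self [OF cring.axioms(1) [OF cring_zpoly_ring] zrelations_carrier] by blast

lemma zideal_0: "0 \<in> zideal"
  using additive_subgroup.zero_closed [OF ideal.axioms(1) [OF ideal_zideal]] by simp

lemma zideal_add: "\<lbrakk>p \<in> zideal; q \<in> zideal\<rbrakk> \<Longrightarrow> p + q \<in> zideal"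
  using additive_subgroup.a_closed [OF ideal.axioms(1) [OF ideal_zideal], of p q] by simp

lemma zideal_mult: "\<lbrakk>p \<in> zideal; q \<in> carrier zpoly_ring\<rbrakk> \<Longrightarrow> p * q \<in> zideal"
  using ideal.I_r_closed [OF ideal_zideal, of p q] by simp

lemma zideal_minus: "p \<in> zideal \<Longrightarrow> - p \<in> zideal"
  using zideal_mult [of p "- 1"] by (simp add: zpoly_carrier)

lemma zideal_diff: "\<lbrakk>p \<in> zideal; q \<in> zideal\<rbrakk> \<Longrightarrow> p - q \<in> zideal"
  using zideal_add [of p "- q"] zideal_minus [of q] by simp

lemma zideal_sum: "(\<And>x. x \<in> A \<Longrightarrow> f x \<in> zideal) \<Longrightarrow> sum f A \<in> zideal"
  by (induction A rule: infinite_finite_induct) (auto intro: zideal_0 zideal_add)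

lemma zideal_idempotent: "v \<in> zvars \<Longrightarrow> zvar v * (1 - zvar v) \<in> zideal"
  by (rule zideal_relation) (auto simp: zvars_def zrelations_def zz_eq_zvar z1_eq_zvar)

text \<open>The zeros of an evaluation form an ideal, and it contains the generators.\<close>

lemma zpoly_eval_zideal:
  assumes a: "\<And>p. p \<in> zrelations \<union> zswap \<Longrightarrow> zpoly_eval a p = 0" and p: "p \<in> zideal"
  shows "zpoly_eval a p = 0"
proof -
  interpret R: cring "zpoly_ring :: 'a zpoly ring" by (rule cring_zpoly_ring)
  let ?I = "{p \<in> carrier zpoly_ring. zpoly_eval a p = 0}"
  have "subgroup ?I (add_monoid zpoly_ring)"
  proof (rule R.add.subgroupI)
    fix p assume "p \<in> ?I"
    then have "\<ominus>\<^bsub>zpoly_ring\<^esub> p = - p"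
      by (intro R.minus_equality) (auto intro: zpoly_carrier)
    with \<open>p \<in> ?I\<close> show "\<ominus>\<^bsub>zpoly_ring\<^esub> p \<in> ?I"
      by (auto intro: zpoly_carrier simp: zpoly_eval_simps)
  qed (auto intro: zpoly_carrier simp: zpoly_eval_simps)
  then have "ideal ?I zpoly_ring"
    by (intro idealI R.ring_axioms) (auto intro: zpoly_carrier simp: zpoly_eval_simps)
  then have "zideal \<subseteq> ?I"
    unfolding zideal_def
    by (rule R.genideal_minimal) (use a zrelations_carrier in auto)
  with p show ?thesis by auto
qed

text \<open>The idempotent of a set \<open>A\<close> of variables is the indicator polynomial of the 0/1 point at which
  exactly the variables in \<open>A\<close> are 1.\<close>

definition point_idempotent :: "'n zvar set \<Rightarrow> 'n zpoly" where
  "point_idempotent A = (\<Prod>v\<in>A. zvar v) * (\<Prod>v\<in>zvars - A. 1 - zvar v)"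

definition point_of :: "'n zvar set \<Rightarrow> 'n zvar \<Rightarrow> int" where
  "point_of A v = (if v \<in> A then 1 else 0)"

lemma point_idempotent_carrier: "A \<subseteq> zvars \<Longrightarrow> point_idempotent A \<in> carrier zpoly_ring"
  unfolding point_idempotent_def by (auto intro!: zpoly_carrier)

text \<open>This is the expansion of the product of \<open>zvar v + (1 - zvar v) = 1\<close> over
  all variables.\<close>

lemma sum_point_idempotent:
  "(\<Sum>A\<in>Pow zvars. point_idempotent A) = (1 :: 'n::finite zpoly)"
  using prod_add [OF finite_zvars, of zvar "\<lambda>v. 1 - zvar v :: 'n zpoly"]
  by (simp add: point_idempotent_def)

text \<open>The idempotent has the factor \<open>zvar v\<close> or \<open>1 - zvar v\<close>,
  according to whether \<open>v\<close> lies in \<open>A\<close>. Together with the first factor it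
  gives, up to sign, the relation \<open>zvar v * (1 - zvar v)\<close>.\<close>

lemma zvar_point_idempotent:
  fixes A :: "'n::finite zvar set"
  assumes v: "v \<in> zvars" and A: "A \<subseteq> zvars"
  shows "(zvar v - of_int (point_of A v)) * point_idempotent A \<in> zideal"
proof -
  have fin: "finite A" "finite (zvars - A)"
    using A finite_zvars finite_subset by blast+
  obtain q where q: "q \<in> carrier zpoly_ring"
    "(zvar v - of_int (point_of A v)) * point_idempotent A = (zvar v * (1 - zvar v)) * q"
  proof (cases "v \<in> A")
    case True
    show ?thesis
    proof
      show "- ((\<Prod>v\<in>A - {v}. zvar v) * (\<Prod>v\<in>zvars - A. 1 - zvar v)) \<in> carrier zpoly_ring"
        using A by (auto intro!: zpoly_carrier)
      show "(zvar v - of_int (point_of A v)) * point_idempotent A =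
          (zvar v * (1 - zvar v)) * - ((\<Prod>v\<in>A - {v}. zvar v) * (\<Prod>v\<in>zvars - A. 1 - zvar v))"
        using True prod.remove [OF fin(1) True, of zvar]
        by (simp add: point_idempotent_def point_of_def algebra_simps)
    qed
  next
    case False
    then have v': "v \<in> zvars - A" using v by simp
    show ?thesis
    proof
      show "(\<Prod>v\<in>A. zvar v) * (\<Prod>v\<in>zvars - A - {v}. 1 - zvar v) \<in> carrier zpoly_ring"
        using A by (auto intro!: zpoly_carrier)
      show "(zvar v - of_int (point_of A v)) * point_idempotent A =
          (zvar v * (1 - zvar v)) * ((\<Prod>v\<in>A. zvar v) * (\<Prod>v\<in>zvars - A - {v}. 1 - zvar v))"
        unfolding point_idempotent_def prod.remove [OF fin(2) v', of "\<lambda>v. 1 - zvar v"]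
        using False by (simp add: point_of_def ac_simps)
    qed
  qed
  then show ?thesis
    using zideal_mult [OF zideal_idempotent [OF v] q(1)] by simp
qed

text \<open>Modulo the ideal, a polynomial acts on the idempotent as its value at the point. This is
  known for variables and is inherited by products and differences.\<close>

lemma evaluate_at_point_idempotent:
  fixes A :: "'n::finite zvar set"
  assumes A: "A \<subseteq> zvars" and p: "p \<in> carrier zpoly_ring"
  shows "(p - of_int (zpoly_eval (point_of A) p)) * point_idempotent A \<in> zideal"
proof -
  define e where "e = point_idempotent A"
  \<comment> \<open>Membership in the carrier is part of \<open>Q\<close> because the product step
    multiplies an element of the ideal by \<open>q'\<close>.\<close>
  define Q where "Q q \<longleftrightarrow> q \<in> carrier zpoly_ring \<and> (q - of_int (zpoly_eval (point_of A) q)) * e \<in> zideal" for q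
  have Q_mult: "Q (q * q')" if "Q q" "Q q'" for q q'
  proof -
    let ?k = "of_int (zpoly_eval (point_of A) q)" and ?k' = "of_int (zpoly_eval (point_of A) q')"
    have "(q * q' - ?k * ?k') * e = ((q - ?k) * e) * q' + ((q' - ?k') * e) * ?k"
      by (simp add: algebra_simps)
    then show ?thesis
      using that by (auto simp: Q_def zpoly_eval_simps intro!: zideal_add zideal_mult zpoly_carrier)
  qed
  have Q_1: "Q 1" by (simp add: Q_def zpoly_eval_simps zpoly_carrier zideal_0)
  have Q_power: "Q (q ^ k)" if "Q q" for q k
    by (induction k) (auto intro: Q_1 Q_mult that)
  have Q_prod: "Q (prod f B)" if "\<And>v. v \<in> B \<Longrightarrow> Q (f v)" for f and B :: "'n zvar set"
    using that by (induction B rule: infinite_finite_induct) (auto intro: Q_1 Q_mult)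
  have Q_zvar: "Q (zvar v)" if "v \<in> zvars" for v
    using zvar_point_idempotent [OF that A] that by (simp add: Q_def e_def zpoly_eval_simps zpoly_carrier)
  have "Q p"
    using p [unfolded carrier_zpoly_ring]
  proof (induction p rule: frag_induction)
    case zero
    show ?case by (simp add: Q_def zpoly_eval_simps zpoly_carrier zideal_0)
  next
    case (one m)
    then show ?case
      unfolding monomial_eq_prod_zvar by (auto intro!: Q_prod Q_power Q_zvar)
  next
    case (diff q q')
    let ?k = "of_int (zpoly_eval (point_of A) q)" and ?k' = "of_int (zpoly_eval (point_of A) q')"
    have "(q - q' - (?k - ?k')) * e = (q - ?k) * e - (q' - ?k') * e"
      by (simp add: algebra_simps)
    then show ?case
      using diff by (auto simp: Q_def zpoly_eval_simps intro!: zideal_diff zpoly_carrier)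
  qed
  then show ?thesis by (simp add: Q_def e_def)
qed

lemma zpoly_eval_point_idempotent:
  fixes A :: "'n::finite zvar set"
  assumes A: "A \<subseteq> zvars" and a: "\<And>v. v \<in> zvars \<Longrightarrow> a v = 0 \<or> a v = 1"
  shows "zpoly_eval a (point_idempotent A) = (if A = {v \<in> zvars. a v = 1} then 1 else 0)"
proof -
  have fin: "finite A" "finite (zvars - A)"
    using A finite_zvars finite_subset by blast+
  have "zpoly_eval a (point_idempotent A) = (\<Prod>v\<in>A. a v) * (\<Prod>v\<in>zvars - A. 1 - a v)"
    by (simp add: point_idempotent_def zpoly_eval_simps zpoly_eval_prod)
  also have "\<dots> = (if A = {v \<in> zvars. a v = 1} then 1 else 0)"
  proof (cases "A = {v \<in> zvars. a v = 1}")
    case True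
    then have "(\<Prod>v\<in>A. a v) = 1" "(\<Prod>v\<in>zvars - A. 1 - a v) = 1"
      by (intro prod.neutral; use a in force)+
    with True show ?thesis by simp
  next
    case False
    then have "(\<exists>v\<in>A. a v = 0) \<or> (\<exists>v\<in>zvars - A. 1 - a v = 0)"
      using A a by auto
    with False fin show ?thesis by (auto simp: prod_zero_iff)
  qed
  finally show ?thesis .
qed

section \<open>Assignments satisfying the relations\<close>

lemma zrelations_cases:
  assumes "p \<in> zrelations \<union> zswap"
  obtains (idem2) i j where "i \<noteq> j" "p = zz i j * (1 - zz i j)"
  | (idem1) i where "p = z1 i * (1 - z1 i)"
  | (bars) i j where "i \<noteq> j" "p = z1 i - z1 j + zz i j - zz (bar i) (bar j)"
  | (neg) i where "p = z1 i - (1 - z1 (bar i))"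
  | (trans) i j k where "i \<noteq> j" "j \<noteq> k" "i \<noteq> k"
      "p = zz i j * zz j k * (1 - zz i k) + (1 - zz i j) * (1 - zz j k) * zz i k"
  | (sign) i j where "i \<noteq> j" "p = zz i j * z1 i * (1 - z1 j) + (1 - zz i j) * (1 - z1 i) * z1 j"
  | (bar_sign) i j where "i \<noteq> j" "i \<noteq> bar j"
      "p = z1 j * zz i (bar j) * (1 - zz i j) + (1 - z1 j) * (1 - zz i (bar j)) * zz i j"
  | (swap) i j where "i \<noteq> j" "p = zz i j - (1 - zz j i)"
  using assms unfolding zrelations_def zswap_def
  by (elim UnE CollectE exE conjE) (rule that, assumption+)+

lemma zrelationsI:
  "i \<noteq> j \<Longrightarrow> z1 i - z1 j + zz i j - zz (bar i) (bar j) \<in> zrelations \<union> zswap"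
  "z1 i - (1 - z1 (bar i)) \<in> zrelations \<union> zswap"
  "\<lbrakk>i \<noteq> j; j \<noteq> k; i \<noteq> k\<rbrakk> \<Longrightarrow>
     zz i j * zz j k * (1 - zz i k) + (1 - zz i j) * (1 - zz j k) * zz i k \<in> zrelations \<union> zswap"
  "i \<noteq> j \<Longrightarrow> zz i j * z1 i * (1 - z1 j) + (1 - zz i j) * (1 - z1 i) * z1 j \<in> zrelations \<union> zswap"
  "i \<noteq> j \<Longrightarrow> zz i j - (1 - zz j i) \<in> zrelations \<union> zswap"
  unfolding zrelations_def zswap_def
      apply (rule UnI1, rule UnI1, rule UnI1, rule UnI1, rule UnI1, rule UnI2, blast)
     apply (rule UnI1, rule UnI1, rule UnI1, rule UnI1, rule UnI2, blast)
    apply (rule UnI1, rule UnI1, rule UnI1, rule UnI2, blast)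
   apply (rule UnI1, rule UnI1, rule UnI2, blast)
  apply (rule UnI2, blast)
  done

lemma bar_inject: "bar i = bar j \<longleftrightarrow> i = j"
  by (cases i; cases j) auto

text \<open>A relation of type (iii) can take the values \<open>\<plusminus>2\<close>, but then one of type (vi) has value 1.
  This is why the quotient has no torsion.\<close>

lemma relation_value_unit:
  assumes a: "\<And>v. v \<in> zvars \<Longrightarrow> a v = 0 \<or> a v = 1"
    and p: "p \<in> zrelations \<union> zswap" and nz: "zpoly_eval a p \<noteq> 0"
  shows "\<exists>q\<in>zrelations \<union> zswap. zpoly_eval a q = 1 \<or> zpoly_eval a q = - 1"
proof -
  have ZZ: "a (ZZ i j) = 0 \<or> a (ZZ i j) = 1" if "i \<noteq> j" for i j
    using a that by (auto simp: zvars_def)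
  have Z: "a (Z i) = 0 \<or> a (Z i) = 1" for i
    using a by (auto simp: zvars_def)
  note ev = zpoly_eval_simps zz_eq_zvar z1_eq_zvar
  from p show ?thesis
  proof (cases rule: zrelations_cases)
    case (bars i j)
    let ?q = "zz i j * z1 i * (1 - z1 j) + (1 - zz i j) * (1 - z1 i) * z1 j"
    have "zpoly_eval a p = 1 \<or> zpoly_eval a p = - 1 \<or> zpoly_eval a ?q = 1"
      using nz ZZ [OF bars(1)] ZZ [of "bar i" "bar j"] Z [of i] Z [of j] bars
      by (auto simp: ev bar_inject)
    then show ?thesis
      using p zrelationsI(4) [OF bars(1)] by blast
  next
    case (idem2 i j)
    then show ?thesis using nz ZZ [of i j] by (auto simp: ev)
  next
    case (idem1 i)
    then show ?thesis using nz Z [of i] by (auto simp: ev)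
  next
    case (neg i)
    then have "zpoly_eval a p = 1 \<or> zpoly_eval a p = - 1"
      using nz Z [of i] Z [of "bar i"] by (auto simp: ev)
    with p show ?thesis by blast
  next
    case (trans i j k)
    then have "zpoly_eval a p = 1 \<or> zpoly_eval a p = - 1"
      using nz ZZ [of i j] ZZ [of j k] ZZ [of i k] by (auto simp: ev)
    with p show ?thesis by blast
  next
    case (sign i j)
    then have "zpoly_eval a p = 1 \<or> zpoly_eval a p = - 1"
      using nz ZZ [of i j] Z [of i] Z [of j] by (auto simp: ev)
    with p show ?thesis by blast
  next
    case (bar_sign i j)
    then have "zpoly_eval a p = 1 \<or> zpoly_eval a p = - 1"
      using nz ZZ [of i j] ZZ [of i "bar j"] Z [of j] by (auto simp: ev)
    with p show ?thesis by blast
  next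
    case (swap i j)
    then have "zpoly_eval a p = 1 \<or> zpoly_eval a p = - 1"
      using nz ZZ [of i j] ZZ [of j i] by (auto simp: ev)
    with p show ?thesis by blast
  qed
qed

text \<open>With signs and logarithms these are finite checks. In the case \<open>bars\<close>,
  equal signs leave the comparison of logarithms unchanged under the bar, while opposite signs
  decide the comparison and the bar reverses it. In \<open>bar_sign\<close>, the sign of coordinate
  \<open>j\<close> decides whether it lies above or below coordinate \<open>bar j\<close>.\<close>

lemma zfun_satisfies_relations:
  assumes x: "x \<in> Zspace" and p: "p \<in> zrelations \<union> zswap"
  shows "zpoly_eval (zfun x) p = 0"
proof -
  note ev = zpoly_eval_simps zz_eq_zvar z1_eq_zvar zfun_ZZ [OF x] zfun_Z [OF x] coord_sgn_bar index_bar
  note sg = coord_sgn_cases [OF x]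
  have less_swap: "zfun x (ZZ i j) = 1 - zfun x (ZZ j i)" if "i \<noteq> j" for i j
    using coord_distinct [OF x that] by auto
  from p show ?thesis
  proof (cases rule: zrelations_cases)
    case (idem2 i j)
    then show ?thesis by (simp add: zpoly_eval_simps zz_eq_zvar)
  next
    case (idem1 i)
    then show ?thesis by (simp add: zpoly_eval_simps z1_eq_zvar)
  next
    case (bars i j)
    then show ?thesis using sg [of i] sg [of j] by (auto simp: ev simp del: zfun.simps)
  next
    case (neg i)
    then show ?thesis using sg [of i] by (auto simp: ev simp del: zfun.simps)
  next
    case (trans i j k)
    then show ?thesis
      using coord_distinct [OF x, of i j] coord_distinct [OF x, of j k]
      by (auto simp: zpoly_eval_simps zz_eq_zvar)
  next
    case (sign i j)
    then show ?thesis using sg [of i] sg [of j] by (auto simp: ev simp del: zfun.simps)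
  next
    case (bar_sign i j)
    then show ?thesis using sg [of i] sg [of j] by (auto simp: ev simp del: zfun.simps)
  next
    case (swap i j)
    then show ?thesis using less_swap [of i j] by (simp add: zpoly_eval_simps zz_eq_zvar)
  qed
qed

text \<open>Exactly one of each index and its bar is declared positive. On these representatives the
  relations make \<open>ZZ\<close> a strict linear order, which is realized by logarithms; the
  comparisons of all other pairs are then forced.\<close>

lemma assignment_realized:
  fixes a :: "'n::finite zvar \<Rightarrow> int"
  assumes a: "\<And>v. v \<in> zvars \<Longrightarrow> a v = 0 \<or> a v = 1"
    and rel: "\<And>p. p \<in> zrelations \<union> zswap \<Longrightarrow> zpoly_eval a p = 0"
  obtains x where "x \<in> Zspace" "\<And>v. v \<in> zvars \<Longrightarrow> zfun x v = a v"
proof -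
  have ZZ: "a (ZZ i j) = 0 \<or> a (ZZ i j) = 1" if "i \<noteq> j" for i j
    using a that by (auto simp: zvars_def)
  have Z: "a (Z i) = 0 \<or> a (Z i) = 1" for i
    using a by (auto simp: zvars_def)
  note ev = zpoly_eval_simps zz_eq_zvar z1_eq_zvar
  have swap: "a (ZZ i j) = 1 - a (ZZ j i)" if "i \<noteq> j" for i j
    using rel [OF zrelationsI(5) [OF that]] by (simp add: ev)
  have neg: "a (Z (bar i)) = 1 - a (Z i)" for i
    using rel [OF zrelationsI(2) [of i]] by (simp add: ev)
  have bars: "a (ZZ (bar i) (bar j)) = a (ZZ i j)" if "i \<noteq> j" "a (Z i) = a (Z j)" for i j
    using rel [OF zrelationsI(1) [OF that(1)]] that(2) by (simp add: ev)
  have trans: "a (ZZ i k) = 1" if "a (ZZ i j) = 1" "a (ZZ j k) = 1" "i \<noteq> j" "j \<noteq> k" "i \<noteq> k" for i j k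
    using rel [OF zrelationsI(3) [OF that(3-5)]] that by (simp add: ev)
  have sign: "a (Z j) = 1" if "a (ZZ i j) = 1" "a (Z i) = 1" "i \<noteq> j" for i j
    using rel [OF zrelationsI(4) [OF that(3)]] that by (simp add: ev)
  define pos where "pos i = (if a (Z (Plain i)) = 1 then Plain i else Barred i)" for i
  have pos_index: "pos (index u) = u" if "a (Z u) = 1" for u
    using that neg [of "Plain (index u)"] by (cases u) (auto simp: pos_def)
  have pos_inject: "pos i = pos j \<longleftrightarrow> i = j" for i j
    by (auto simp: pos_def split: if_splits)
  define lt where "lt i j \<longleftrightarrow> i \<noteq> j \<and> a (ZZ (pos i) (pos j)) = 1" for i j
  have lt_total: "lt i j \<or> lt j i" if "i \<noteq> j" for i j
    using that ZZ [of "pos i" "pos j"] swap [of "pos i" "pos j"] by (auto simp: lt_def pos_inject)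
  have lt_asym: "\<not> lt j i" if "lt i j" for i j
    using that swap [of "pos i" "pos j"] by (auto simp: lt_def pos_inject)
  have lt_trans: "lt i k" if "lt i j" "lt j k" for i j k
  proof -
    have "i \<noteq> k" using that lt_asym by blast
    then show ?thesis
      using that trans [of "pos i" "pos j" "pos k"] by (auto simp: lt_def pos_inject)
  qed
  \<comment> \<open>The number of predecessors turns the abstract order into real numbers, which
    serve as logarithms.\<close>
  define rank where "rank i = real (card {j. lt j i})" for i
  have rank_less: "rank i < rank j" if "lt i j" for i j
  proof -
    have "{k. lt k i} \<subset> {k. lt k j}"
      using that lt_trans lt_asym by blast
    then show ?thesis
      by (simp add: rank_def psubset_card_mono)
  qed
  have rank_less_iff: "rank i < rank j \<longleftrightarrow> lt i j" for i j
    using rank_less [of i j] rank_less [of j i] lt_total [of i j] by (cases "i = j") (auto simp: lt_def)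
  define s where "s i = (if a (Z (Plain i)) = 1 then 1 else - 1 :: real)" for i
  define x where "x = (\<chi> i. signed_exp (s i) (rank i))"
  have s: "s i = 1 \<or> s i = - 1" for i by (simp add: s_def)
  have sgn_x: "sgn (x $ i) = s i" and ln_x: "signed_ln (x $ i) = rank i" for i
    using s by (simp_all add: x_def sgn_signed_exp signed_ln_exp)
  have "x $ i \<noteq> 0" for i
    using sgn_x [of i] s [of i] by auto
  moreover have "rank i \<noteq> rank j" if "i \<noteq> j" for i j
    using lt_total [OF that] rank_less by fastforce
  ultimately have x: "x \<in> Zspace"
    by (simp add: Zspace_iff ln_x)
  have sgn_coord: "coord_sgn x u = (if a (Z u) = 1 then 1 else - 1)" for u
    using neg [of "Plain (index u)"] Z [of u] by (cases u) (auto simp: sgn_x s_def)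
  have "zfun x v = a v" if "v \<in> zvars" for v
  proof (cases v)
    case (Z u)
    then show ?thesis
      using a [OF that] by (auto simp: zfun_Z [OF x] sgn_coord simp del: zfun.simps)
  next
    case (ZZ u w)
    with that have uw: "u \<noteq> w" by (auto simp: zvars_def)
    have zf: "zfun x (ZZ u w) = (if coord_sgn x u < coord_sgn x w \<or>
        coord_sgn x u = coord_sgn x w \<and> lt (index u) (index w) then 1 else 0)"
      by (simp add: zfun_ZZ [OF x] ln_x rank_less_iff del: zfun.simps)
    have same: "lt (index u') (index w') \<longleftrightarrow> a (ZZ u' w') = 1"
      if "a (Z u') = 1" "a (Z w') = 1" "u' \<noteq> w'" for u' w'
      using that pos_index [of u'] pos_index [of w'] by (auto simp: lt_def)
    \<comment> \<open>Two positive indices are compared by \<open>lt\<close>, two negative ones by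
      passing to their bars. For mixed signs the wrong value would, by \<open>sign\<close> (after
      \<open>swap\<close> in the third case), make the negative index positive.\<close>
    consider "a (Z u) = 1" "a (Z w) = 1" | "a (Z u) = 0" "a (Z w) = 0"
      | "a (Z u) = 0" "a (Z w) = 1" | "a (Z u) = 1" "a (Z w) = 0"
      using Z [of u] Z [of w] by blast
    then have "zfun x (ZZ u w) = a (ZZ u w)"
    proof cases
      case 1
      then show ?thesis
        using same [OF 1 uw] a [OF that] ZZ by (auto simp: zf sgn_coord simp del: zfun.simps)
    next
      case 2
      then have "lt (index (bar u)) (index (bar w)) \<longleftrightarrow> a (ZZ (bar u) (bar w)) = 1"
        using uw by (intro same) (auto simp: neg bar_inject)
      with 2 show ?thesis
        using bars [OF uw] a [OF that] ZZ by (auto simp: zf sgn_coord index_bar simp del: zfun.simps)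
    next
      case 3
      then show ?thesis
        using sign [of w u] swap [OF uw] uw a [OF that] ZZ by (auto simp: zf sgn_coord simp del: zfun.simps)
    next
      case 4
      then show ?thesis
        using sign [of u w] uw a [OF that] ZZ by (auto simp: zf sgn_coord simp del: zfun.simps)
    qed
    then show ?thesis by (simp add: ZZ del: zfun.simps)
  qed
  with x show ?thesis by (rule that)
qed

section \<open>Polynomials as functions on the space\<close>

lemma zfun_01: "zfun x v = 0 \<or> zfun x v = 1"
  by (cases v) auto

text \<open>Since the idempotents sum to 1, it suffices to treat each
  \<open>p * point_idempotent A\<close>. At a realized assignment the value of \<open>p\<close> is
  0; at any other the idempotent itself lies in the ideal.\<close>

lemma zideal_iff_vanishes:
  fixes p :: "'n::finite zpoly"
  assumes p: "p \<in> carrier zpoly_ring"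
  shows "p \<in> zideal \<longleftrightarrow> (\<forall>x\<in>Zspace. zpoly_eval (zfun x) p = 0)"
proof
  assume "p \<in> zideal"
  then show "\<forall>x\<in>Zspace. zpoly_eval (zfun x) p = 0"
    using zpoly_eval_zideal zfun_satisfies_relations by blast
next
  assume vanishes: "\<forall>x\<in>Zspace. zpoly_eval (zfun x) p = 0"
  have "p * point_idempotent A \<in> zideal" if A: "A \<subseteq> zvars" for A
  proof (cases "\<forall>q \<in> zrelations \<union> zswap. zpoly_eval (point_of A) q = 0")
    case True
    obtain x where x: "x \<in> Zspace" "\<And>v. v \<in> zvars \<Longrightarrow> zfun x v = point_of A v"
      by (rule assignment_realized [of "point_of A"]) (use True in \<open>auto simp: point_of_def\<close>)
    have "zpoly_eval (point_of A) p = zpoly_eval (zfun x) p"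
      by (rule zpoly_eval_cong [OF p]) (simp add: x)
    then show ?thesis
      using evaluate_at_point_idempotent [OF A p] vanishes x(1) by simp
  next
    case False
    then obtain q where q: "q \<in> zrelations \<union> zswap"
      and unit: "zpoly_eval (point_of A) q = 1 \<or> zpoly_eval (point_of A) q = - 1"
      using relation_value_unit [of "point_of A"] by (metis point_of_def)
    let ?e = "point_idempotent A"
    have "q \<in> zideal" by (rule zideal_relation [OF q])
    \<comment> \<open>The two members differ by the value of \<open>q\<close> times
      \<open>?e\<close>. As that value is a unit, \<open>?e\<close> itself follows, not just a
      multiple of it.\<close>
    then have qe: "q * ?e \<in> zideal" "(q - of_int (zpoly_eval (point_of A) q)) * ?e \<in> zideal"
      using zideal_mult point_idempotent_carrier [OF A] evaluate_at_point_idempotent [OF A] zideal_carrier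
      by blast+
    have "?e \<in> zideal"
      using unit
    proof
      assume "zpoly_eval (point_of A) q = 1"
      then show ?thesis
        using zideal_diff [OF qe] by (simp add: algebra_simps)
    next
      assume "zpoly_eval (point_of A) q = - 1"
      then show ?thesis
        using zideal_diff [OF qe(2,1)] by (simp add: algebra_simps)
    qed
    then show ?thesis
      using zideal_mult [OF _ p] by (metis mult.commute)
  qed
  then have "(\<Sum>A\<in>Pow zvars. p * point_idempotent A) \<in> zideal"
    by (intro zideal_sum) auto
  then show "p \<in> zideal"
    by (simp add: sum_distrib_left [symmetric] sum_point_idempotent)
qed

lemma zpoly_interpolation:
  fixes F :: "real ^ 'n::finite \<Rightarrow> int"
  assumes F: "\<And>x y. \<lbrakk>x \<in> Zspace; y \<in> Zspace; \<And>v. v \<in> zvars \<Longrightarrow> zfun x v = zfun y v\<rbrakk> \<Longrightarrow> F x = F y"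
  obtains p where "p \<in> carrier zpoly_ring" "\<And>x. x \<in> Zspace \<Longrightarrow> zpoly_eval (zfun x) p = F x"
proof
  let ?V = "\<lambda>x :: real ^ 'n. {v \<in> zvars. zfun x v = 1}"
  \<comment> \<open>For \<open>A\<close> realized by no point the choice is arbitrary; this is
    harmless, since \<open>point_idempotent A\<close> then evaluates to 0 at every point of
    \<open>Zspace\<close>.\<close>
  define G where "G A = F (SOME x. x \<in> Zspace \<and> ?V x = A)" for A
  let ?p = "\<Sum>A\<in>Pow zvars. of_int (G A) * point_idempotent A"
  show "?p \<in> carrier zpoly_ring"
    by (auto intro!: zpoly_carrier point_idempotent_carrier)
  fix x :: "real ^ 'n" assume x: "x \<in> Zspace"
  have "zpoly_eval (zfun x) ?p = (\<Sum>A\<in>Pow zvars. G A * (if A = ?V x then 1 else 0))"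
    unfolding zpoly_eval_sum zpoly_eval_mult zpoly_eval_of_int
    by (intro sum.cong refl) (simp add: zpoly_eval_point_idempotent zfun_01)
  also have "\<dots> = G (?V x)"
    using finite_zvars [where 'n = 'n]
    by (simp add: if_distrib [of "\<lambda>t. _ * t"] sum.delta cong: if_cong)
  also have "\<dots> = F x"
  proof -
    define y where "y = (SOME y. y \<in> Zspace \<and> ?V y = ?V x)"
    have "y \<in> Zspace \<and> ?V y = ?V x"
      unfolding y_def by (rule someI [of _ x]) (use x in simp)
    then have "F y = F x"
      using x zfun_01 [of x] zfun_01 [of y] by (intro F) (auto simp: set_eq_iff, metis)
    then show ?thesis by (simp add: G_def y_def)
  qed
  finally show "zpoly_eval (zfun x) ?p = F x" .
qed

text \<open>Lets the first isomorphism theorem for groups act on the additive group of the quotient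
  ring.\<close>

lemma add_monoid_FactRing: "add_monoid (R Quot I) = add_monoid R Mod I"
  by (simp add: FactRing_def FactGroup_def A_RCOSETS_def set_add_def)

theorem theorem3p10:
  "\<exists>\<Phi> \<in> iso (add_monoid (zpoly_ring Quot (zideal :: 'n::finite zpoly set)))
             (total_cohomology (top_of_set (Zspace :: (real ^ 'n) set))).
     \<forall>p \<in> carrier zpoly_ring.
       \<Phi> (zideal +>\<^bsub>zpoly_ring\<^esub> p) =
         function_class (top_of_set Zspace) (\<lambda>x. zpoly_eval (zfun x) p)"
proof -
  let ?X = "top_of_set (Zspace :: (real ^ 'n) set)"
  let ?R = "zpoly_ring :: 'n zpoly ring"
  let ?f = "\<lambda>p x. zpoly_eval (zfun x) (p :: 'n zpoly)"
  define \<Psi> where "\<Psi> p = function_class ?X (?f p)" for p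
  interpret R: cring ?R by (rule cring_zpoly_ring)
  interpret homotopically_discrete ?X "straighten 1"
    by (rule homotopically_discrete_Zspace)
  \<comment> \<open>No carrier condition on \<open>p\<close> is required, as the whole function
    \<open>zfun\<close> agrees at the two ends of a path.\<close>
  have cocycle: "function_cochain ?X (?f p) \<in> carrier (cocycle_group 0 ?X)" for p
  proof (rule function_cochain_in_cocycle_group)
    fix \<sigma> assume "singular_simplex 1 ?X \<sigma>"
    then have "zfun (simplicial_vertex 0 \<sigma>) = zfun (simplicial_vertex 1 \<sigma>)"
      unfolding simplicial_vertex_def by (intro ext zfun_constant_on_simplex) auto
    then show "?f p (simplicial_vertex 0 \<sigma>) = ?f p (simplicial_vertex 1 \<sigma>)" by simp
  qed
  have \<Psi>_eq: "\<Psi> p = (\<lambda>k. if k = 0 then {function_cochain ?X (?f p)} else \<one>\<^bsub>cohomology_group k ?X\<^esub>)" for p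
    by (simp add: \<Psi>_def function_class_def coset_0_cocycle [OF cocycle] fun_eq_iff)
  have group_T: "group (total_cohomology ?X)"
    unfolding total_cohomology_def by (simp add: group_cohomology_group)
  have \<Psi>_carrier: "\<Psi> p \<in> carrier (total_cohomology ?X)" for p
    using cocycle by (simp add: carrier_total_cohomology \<Psi>_eq carrier_cohomology_group_0)
  have \<Psi>_add: "\<Psi> (p + q) = \<Psi> p \<otimes>\<^bsub>total_cohomology ?X\<^esub> \<Psi> q" for p q
  proof
    fix k
    interpret H: group "cohomology_group k ?X" by (rule group_cohomology_group)
    show "\<Psi> (p + q) k = (\<Psi> p \<otimes>\<^bsub>total_cohomology ?X\<^esub> \<Psi> q) k"
      by (cases "k = 0") (simp_all add: \<Psi>_eq total_cohomology_def mult_cohomology_group_0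
          function_cochain_add zpoly_eval_add)
  qed
  interpret \<Psi>: group_hom "add_monoid ?R" "total_cohomology ?X" \<Psi>
    by (intro group_hom.intro group_hom_axioms.intro R.add.is_group group_T)
       (simp add: hom_def \<Psi>_carrier \<Psi>_add)
  have one_T: "\<one>\<^bsub>total_cohomology ?X\<^esub> =
      (\<lambda>k. if k = 0 then {function_cochain ?X (\<lambda>x. 0)} else \<one>\<^bsub>cohomology_group k ?X\<^esub>)"
    by (auto simp: total_cohomology_def one_cohomology_group coboundary_set_def function_cochain_zero fun_eq_iff)
  have kernel: "kernel (add_monoid ?R) (total_cohomology ?X) \<Psi> = zideal"
  proof -
    have "\<Psi> p = \<one>\<^bsub>total_cohomology ?X\<^esub> \<longleftrightarrow> function_cochain ?X (?f p) = function_cochain ?X (\<lambda>x. 0)" for p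
      unfolding \<Psi>_eq one_T by (auto simp: fun_eq_iff)
    then show ?thesis
      using zideal_carrier zideal_iff_vanishes by (fastforce simp: kernel_def function_cochain_eq_iff)
  qed
  have surj: "\<Psi> ` carrier (add_monoid ?R) = carrier (total_cohomology ?X)"
  proof (intro equalityI subsetI)
    fix y assume y: "y \<in> carrier (total_cohomology ?X)"
    then obtain g where g: "g \<in> carrier (cocycle_group 0 ?X)" "y 0 = {g}"
      by (auto simp: carrier_total_cohomology carrier_cohomology_group_0)
    obtain F where F: "g = function_cochain ?X F" "\<And>x. x \<in> Zspace \<Longrightarrow> F x = F (straighten 1 x)"
      using cocycle_0_eq_function_cochain [OF g(1)] by auto
    \<comment> \<open>\<open>F\<close> factors through \<open>straighten 1\<close>, which sees only
      the values of the variables; this is the hypothesis of the interpolation.\<close>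
    have "F x = F x'" if "x \<in> Zspace" "x' \<in> Zspace" "\<And>v. v \<in> zvars \<Longrightarrow> zfun x v = zfun x' v" for x x'
      using straighten_1_cong [OF that] F(2) that by metis
    then obtain p where p: "p \<in> carrier ?R" "\<And>x. x \<in> Zspace \<Longrightarrow> ?f p x = F x"
      using zpoly_interpolation by metis
    then have "function_cochain ?X (?f p) = g"
      by (simp add: F(1) function_cochain_eq_iff)
    then have "\<Psi> p = y"
      using y g(2) by (auto simp: \<Psi>_eq carrier_total_cohomology fun_eq_iff)
    with p(1) show "y \<in> \<Psi> ` carrier (add_monoid ?R)" by auto
  qed (use \<Psi>_carrier in auto)
  show ?thesis
  proof (intro bexI ballI)
    show "(\<lambda>C. the_elem (\<Psi> ` C)) \<in> iso (add_monoid (?R Quot zideal)) (total_cohomology ?X)"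
      using \<Psi>.FactGroup_iso_set [OF surj] unfolding add_monoid_FactRing kernel .
    fix p assume p: "p \<in> carrier ?R"
    \<comment> \<open>\<open>the_elem\<close> yields the expected value because the image of a coset
      is a singleton.\<close>
    have "\<Psi> q = \<Psi> p" if q: "q \<in> zideal +>\<^bsub>?R\<^esub> p" for q
    proof -
      obtain h where h: "h \<in> zideal" "q = h + p"
        using q by (auto simp: a_r_coset_def r_coset_def)
      have "h \<in> kernel (add_monoid ?R) (total_cohomology ?X) \<Psi>"
        using h(1) unfolding kernel .
      then show ?thesis
        using h(2) \<Psi>_add [of h p] \<Psi>.H.l_one [OF \<Psi>_carrier] by (simp add: kernel_def)
    qed
    moreover have "p \<in> zideal +>\<^bsub>?R\<^esub> p"
      using zideal_0 by (auto simp: a_r_coset_def r_coset_def)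
    ultimately have "\<Psi> ` (zideal +>\<^bsub>?R\<^esub> p) = {\<Psi> p}" by blast
    then show "the_elem (\<Psi> ` (zideal +>\<^bsub>?R\<^esub> p)) = function_class ?X (?f p)"
      by (simp add: \<Psi>_def)
  qed
qed

end
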